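(* Assume $\|X\|/p\le\lambda\le 2\bar\lambda$ with $\bar\lambda=2\|X\|\sqrt{\log p}$, and that there are constants $A_1,A_2,A_3,A_4>0$ (not depending on $p$) such that $A_1p^{-A_3}\pi_p(s-1)\le\pi_p(s)\le A_2p^{-A_4}\pi_p(s-1)$ for $s=1,\dots,p$. Then for every $M>2$, \[ \sup_{\beta^0\in\mathbb R^p}\mathbb E_{\beta^0}\Pi\Big(\beta:\ |S_\beta|>s_0+\frac{M}{A_4}\Big(1+\frac{16}{\phi(S_0)^2}\frac{\lambda}{\bar\lambda}\Big)s_0\ \Big|\ Y\Big)\to0 \] as $n,p\to\infty$, where $S_0=S_{\beta^0}$ and $s_0=|S_0|$.
   Context: Observations follow $Y=X\beta+\varepsilon$ with $X$ a deterministic real $n\times p$ matrix and $\varepsilon\sim N_n(0,I_n)$. For $\beta^0\in\mathbb R^p$, $\mathbb E_{\beta^0}$ denotes expectation when $Y\sim N_n(X\beta^0,I_n)$. For $\beta\in\mathbb R^p$, $S_\beta=\{i:\beta_i\neq0\}$; for $S\subset\{1,\dots,p\}$, $\beta_S=(\beta_i)_{i\in S}$ and $S^c$ is the complement. $X_{\cdot,i}$ is the $i$th column of $X$ and $\|X\|=\max_{i}\|X_{\cdot,i}\|_2$. The prior $\Pi$ on $\mathbb R^p$: draw $s$ from a probability $\pi_p$ on $\{0,\dots,p\}$, then $S$ uniformly among subsets of $\{1,\dots,p\}$ of size $s$, then $\beta_i$, $i\in S$, i.i.d. with Laplace density $x\mapsto\frac{\lambda}{2}e^{-\lambda|x|}$,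 and $\beta_i=0$ for $i\notin S$. The posterior is $\Pi(B\mid Y)=\int_Be^{-\|Y-X\beta\|_2^2/2}d\Pi(\beta)/\int e^{-\|Y-X\beta\|_2^2/2}d\Pi(\beta)$. The compatibility number of $S$ is $\phi(S)=\inf\{\|X\beta\|_2|S|^{1/2}/(\|X\|\,\|\beta_S\|_1):\ \beta\in\mathbb R^p,\ \|\beta_{S^c}\|_1\le7\|\beta_S\|_1,\ \beta_S\neq0\}$. Asymptotics: $n,p\to\infty$, with $X$, $\lambda$ and $\pi_p$ allowed to depend on $n,p$ subject to the stated assumptions (the constants $A_i$ are fixed). *)

theory Defs
  imports "HOL-Probability.Probability"
begin

text \<open>Vectors in R^p are functions nat => real vanishing outside {..<p};
  the design matrix X is a function nat => nat => real, entry (i,j) for i<n, j<p.\<close>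

definition supp :: "(nat \<Rightarrow> real) \<Rightarrow> nat set" where
  "supp \<beta> = {i. \<beta> i \<noteq> 0}"

definition vecs :: "nat \<Rightarrow> (nat \<Rightarrow> real) set" where
  "vecs p = {\<beta>. \<forall>i\<ge>p. \<beta> i = 0}"

definition Xmul :: "nat \<Rightarrow> (nat \<Rightarrow> nat \<Rightarrow> real) \<Rightarrow> (nat \<Rightarrow> real) \<Rightarrow> nat \<Rightarrow> real" where
  "Xmul p X \<beta> i = (\<Sum>j<p. X i j * \<beta> j)"

definition sqloss :: "nat \<Rightarrow> nat \<Rightarrow> (nat \<Rightarrow> nat \<Rightarrow> real) \<Rightarrow> (nat \<Rightarrow> real) \<Rightarrow> (nat \<Rightarrow> real) \<Rightarrow> real" where
  "sqloss n p X Y \<beta> = (\<Sum>i<n. (Y i - Xmul p X \<beta> i)\<^sup>2)"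

definition colnorm :: "nat \<Rightarrow> nat \<Rightarrow> (nat \<Rightarrow> nat \<Rightarrow> real) \<Rightarrow> real" where
  "colnorm n p X = Max ((\<lambda>j. sqrt (\<Sum>i<n. (X i j)\<^sup>2)) ` {..<p})"

definition l1 :: "nat set \<Rightarrow> (nat \<Rightarrow> real) \<Rightarrow> real" where
  "l1 S \<beta> = (\<Sum>i\<in>S. \<bar>\<beta> i\<bar>)"

definition compat :: "nat \<Rightarrow> nat \<Rightarrow> (nat \<Rightarrow> nat \<Rightarrow> real) \<Rightarrow> nat set \<Rightarrow> real" where
  "compat n p X S = Inf {sqrt (\<Sum>i<n. (Xmul p X \<beta> i)\<^sup>2) * sqrt (real (card S)) / (colnorm n p X * l1 S \<beta>) | \<beta>.
      \<beta> \<in> vecs p \<and> l1 ({..<p} - S) \<beta> \<le> 7 * l1 S \<beta> \<and> (\<exists>i\<in>S. \<beta> i \<noteq> 0)}"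

definition ext :: "nat set \<Rightarrow> (nat \<Rightarrow> real) \<Rightarrow> nat \<Rightarrow> real" where
  "ext S x = (\<lambda>i. if i \<in> S then x i else 0)"

definition laplace_dens :: "real \<Rightarrow> real \<Rightarrow> real" where
  "laplace_dens lam x = lam / 2 * exp (- lam * \<bar>x\<bar>)"

text \<open>Unnormalised posterior mass of B:  integral over B of exp(-|Y - X beta|^2/2) dPi(beta),
  with Pi the spike-and-slab prior with Laplace slabs, written out explicitly as a mixture.\<close>
definition post_num :: "nat \<Rightarrow> nat \<Rightarrow> (nat \<Rightarrow> nat \<Rightarrow> real) \<Rightarrow> real \<Rightarrow> (nat \<Rightarrow> real)
    \<Rightarrow> (nat \<Rightarrow> real) \<Rightarrow> (nat \<Rightarrow> real) set \<Rightarrow> real" where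
  "post_num n p X lam \<pi> Y B =
     (\<Sum>s\<le>p. \<pi> s / real (p choose s) *
        (\<Sum>S\<in>{S. S \<subseteq> {..<p} \<and> card S = s}.
           \<integral>x. indicator B (ext S x) * exp (- sqloss n p X Y (ext S x) / 2)
                 * (\<Prod>i\<in>S. laplace_dens lam (x i)) \<partial>(PiM S (\<lambda>_. lborel))))"

definition posterior :: "nat \<Rightarrow> nat \<Rightarrow> (nat \<Rightarrow> nat \<Rightarrow> real) \<Rightarrow> real \<Rightarrow> (nat \<Rightarrow> real)
    \<Rightarrow> (nat \<Rightarrow> real) \<Rightarrow> (nat \<Rightarrow> real) set \<Rightarrow> real" where
  "posterior n p X lam \<pi> Y B = post_num n p X lam \<pi> Y B / post_num n p X lam \<pi> Y UNIV"

definition expect :: "nat \<Rightarrow> nat \<Rightarrow> (nat \<Rightarrow> nat \<Rightarrow> real) \<Rightarrow> (nat \<Rightarrow> real)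
    \<Rightarrow> ((nat \<Rightarrow> real) \<Rightarrow> real) \<Rightarrow> real" where
  "expect n p X \<beta>0 f =
     (\<integral>y. f y * (\<Prod>i<n. std_normal_density (y i - Xmul p X \<beta>0 i)) \<partial>(PiM {..<n} (\<lambda>_. lborel)))"

end

theory Submission
  imports Defs "HOL-Real_Asymp.Real_Asymp"
begin

text \<open>
  The normalising constant is bounded below by the contribution of the true support \<open>S0\<close>, which costs
  a factor \<open>(e p)\<^bsup>2 s0\<^esup> / \<pi>(s0)\<close>. In the numerator, on the event that all \<open>\<bar>X\<^sub>j\<^sup>T\<epsilon>\<bar>\<close> are at most
  \<open>L = 2 \<parallel>X\<parallel> sqrt (ln p)\<close>, a fraction \<open>lam / (2 L) \<le> 1\<close> of the noise term is absorbed into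
  \<open>lam / 2 * \<parallel>\<beta> - \<beta>0\<parallel>\<^sub>1\<close>, and the rest has an explicit expectation that leaves a
  fraction of \<open>- \<parallel>X(\<beta> - \<beta>0)\<parallel>\<^sup>2\<close> in the exponent. Through the compatibility number, this negative
  quadratic term pays for the part of the \<open>\<ell>\<^sub>1\<close>-norm on \<open>S0\<close> at the price \<open>p\<^bsup>16 lam s0 / (L \<phi>\<^sup>2)\<^esup>\<close>; the
  slab integral over a model of size \<open>s\<close> is then at most \<open>4\<^sup>s\<close>. The decay
  \<open>\<pi>(s) / \<pi>(s0) \<le> (A2 p\<^bsup>-A4\<^esup>)\<^bsup>s - s0\<^esup>\<close> outweighs all these factors once \<open>s - s0\<close> exceeds the stated
  multiple of \<open>s0\<close>, because \<open>M > 2\<close>.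
\<close>


section \<open>Gaussian and Laplace integrals\<close>

text \<open>Completing the square: the tilted density is \<open>exp (c^2 / 2)\<close> times the
  normal density whose mean is moved to \<open>m + c\<close>.\<close>

lemma gauss_mgf_1d:
  "(\<integral>\<^sup>+y. ennreal (std_normal_density (y - m) * exp (c * (y - m))) \<partial>lborel) = ennreal (exp (c\<^sup>2 / 2))"
proof -
  have eq: "std_normal_density (y - m) * exp (c * (y - m)) = exp (c\<^sup>2 / 2) * normal_density (m + c) 1 y" for y
  proof -
    have "- ((y - m)\<^sup>2 / 2) + c * (y - m) = c\<^sup>2 / 2 + - ((y - (m + c))\<^sup>2 / 2)"
      by (simp add: power2_eq_square field_simps)
    then show ?thesis
      by (simp add: normal_density_def std_normal_density_def flip: exp_add)
  qed
  have "(\<integral>\<^sup>+y. ennreal (std_normal_density (y - m) * exp (c * (y - m))) \<partial>lborel)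
      = ennreal (exp (c\<^sup>2 / 2)) * (\<integral>\<^sup>+y. ennreal (normal_density (m + c) 1 y) \<partial>lborel)"
    unfolding eq by (subst nn_integral_cmult[symmetric]) (auto simp: ennreal_mult)
  also have "(\<integral>\<^sup>+y. ennreal (normal_density (m + c) 1 y) \<partial>lborel) = 1"
    by (subst nn_integral_eq_integral) auto
  finally show ?thesis by simp
qed

interpretation lborel_prod: product_sigma_finite "\<lambda>_::nat. lborel :: real measure"
  by standard

lemma nn_integral_PiM_prod:
  fixes f :: "nat \<Rightarrow> real \<Rightarrow> real"
  assumes "finite I" "\<And>i. i \<in> I \<Longrightarrow> f i \<in> borel_measurable borel"
    and nn: "\<And>i x. i \<in> I \<Longrightarrow> 0 \<le> f i x"
  shows "(\<integral>\<^sup>+x. ennreal (\<Prod>i\<in>I. f i (x i)) \<partial>(PiM I (\<lambda>_. lborel)))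
       = (\<Prod>i\<in>I. \<integral>\<^sup>+x. ennreal (f i x) \<partial>lborel)"
proof -
  have "(\<integral>\<^sup>+x. ennreal (\<Prod>i\<in>I. f i (x i)) \<partial>(PiM I (\<lambda>_. lborel)))
      = (\<integral>\<^sup>+x. (\<Prod>i\<in>I. ennreal (f i (x i))) \<partial>(PiM I (\<lambda>_. lborel)))"
    using nn by (simp add: prod_ennreal)
  also have "\<dots> = (\<Prod>i\<in>I. \<integral>\<^sup>+x. ennreal (f i x) \<partial>lborel)"
    using assms by (intro lborel_prod.product_nn_integral_prod) auto
  finally show ?thesis .
qed

lemma gauss_mgf:
  fixes m c :: "nat \<Rightarrow> real"
  shows "(\<integral>\<^sup>+y. ennreal ((\<Prod>i<n. std_normal_density (y i - m i)) * exp (\<Sum>i<n. c i * (y i - m i)))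
            \<partial>(PiM {..<n} (\<lambda>_. lborel))) = ennreal (exp ((\<Sum>i<n. (c i)\<^sup>2) / 2))"
proof -
  have "(\<Prod>i<n. std_normal_density (y i - m i)) * exp (\<Sum>i<n. c i * (y i - m i))
      = (\<Prod>i<n. std_normal_density (y i - m i) * exp (c i * (y i - m i)))" for y
    by (simp add: exp_sum prod.distrib)
  note eq = this
  have "(\<integral>\<^sup>+y. ennreal ((\<Prod>i<n. std_normal_density (y i - m i)) * exp (\<Sum>i<n. c i * (y i - m i)))
            \<partial>(PiM {..<n} (\<lambda>_. lborel)))
      = (\<Prod>i<n. \<integral>\<^sup>+y. ennreal (std_normal_density (y - m i) * exp (c i * (y - m i))) \<partial>lborel)"
    unfolding eq by (intro nn_integral_PiM_prod) auto
  also have "\<dots> = ennreal (exp ((\<Sum>i<n. (c i)\<^sup>2) / 2))"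
    by (simp add: gauss_mgf_1d prod_ennreal exp_sum sum_divide_distrib)
  finally show ?thesis .
qed

text \<open>Translation and reflection reduce this to a one-sided exponential. The prefactor
  \<open>K\<close> is kept apart from the rate \<open>a\<close> because two cases occur later: the
  Laplace density itself, with mass 1, and the prefactor \<open>lam / 2\<close> with the weaker rate
  \<open>lam / 4\<close>, with mass 4.\<close>

lemma nn_integral_laplace:
  assumes "a > 0" "K \<ge> 0"
  shows "(\<integral>\<^sup>+x. ennreal (K * exp (- a * \<bar>x - c\<bar>)) \<partial>lborel) = ennreal (2 * K / a)"
proof -
  have half: "(\<integral>\<^sup>+x. ennreal (exp (- a * x)) * indicator {0..} x \<partial>lborel) = ennreal (1 / a)"
  proof -
    have "((\<lambda>x. - exp (- a * x) / a) \<longlongrightarrow> 0) at_top"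
      using assms(1) by real_asymp
    then have "(\<integral>\<^sup>+x. ennreal (exp (- a * x)) * indicator {0..} x \<partial>lborel) = 0 - (- exp (- a * 0) / a)"
      using assms by (intro nn_integral_FTC_atLeast) (auto intro!: derivative_eq_intros)
    then show ?thesis by simp
  qed
  have "(\<integral>\<^sup>+x. ennreal (exp (- a * \<bar>x - c\<bar>)) \<partial>lborel)
      = (\<integral>\<^sup>+x. ennreal (exp (- a * \<bar>x\<bar>)) \<partial>lborel)"
    by (subst nn_integral_real_affine[where c = 1 and t = c]) auto
  \<comment> \<open>At \<open>0\<close> both indicators are 1, so this splitting into half-lines
    holds only almost everywhere.\<close>
  also have "\<dots> = (\<integral>\<^sup>+x. ennreal (exp (- a * x)) * indicator {0..} x
                    + ennreal (exp (- a * (- x))) * indicator {0..} (- x) \<partial>lborel)"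
    by (intro nn_integral_cong_AE eventually_mono[OF AE_lborel_singleton[of 0]])
       (auto simp: indicator_def abs_if)
  also have "\<dots> = (\<integral>\<^sup>+x. ennreal (exp (- a * x)) * indicator {0..} x \<partial>lborel)
        + (\<integral>\<^sup>+x. ennreal (exp (- a * (- x))) * indicator {0..} (- x) \<partial>lborel)"
    by (intro nn_integral_add) auto
  also have "(\<integral>\<^sup>+x. ennreal (exp (- a * (- x))) * indicator {0..} (- x) \<partial>lborel)
     = (\<integral>\<^sup>+x. ennreal (exp (- a * x)) * indicator {0..} x \<partial>lborel)"
    by (subst nn_integral_real_affine[where c = "-1" and t = 0]) auto
  finally have one: "(\<integral>\<^sup>+x. ennreal (exp (- a * \<bar>x - c\<bar>)) \<partial>lborel) = ennreal (2 / a)"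
    unfolding half using assms by (simp flip: ennreal_plus)
  have "(\<integral>\<^sup>+x. ennreal (K * exp (- a * \<bar>x - c\<bar>)) \<partial>lborel)
      = ennreal K * (\<integral>\<^sup>+x. ennreal (exp (- a * \<bar>x - c\<bar>)) \<partial>lborel)"
    using assms by (subst nn_integral_cmult[symmetric]) (auto simp: ennreal_mult')
  also have "\<dots> = ennreal (2 * K / a)"
    unfolding one using assms by (simp add: mult.commute flip: ennreal_mult)
  finally show ?thesis .
qed

lemma nn_integral_laplace_dens:
  assumes "lam > 0"
  shows "(\<integral>\<^sup>+x. ennreal (laplace_dens lam x) \<partial>lborel) = 1"
  using nn_integral_laplace[of lam "lam / 2" 0] assms by (simp add: laplace_dens_def)

text \<open>By \<open>exp u \<ge> 1 + u\<close>, the linear term integrates to zero over a symmetric interval.\<close>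

lemma nn_integral_exp_symmetric_interval:
  assumes "0 \<le> (r::real)"
  shows "ennreal (2 * r) \<le> (\<integral>\<^sup>+x. ennreal (indicator {b - r..b + r} x * exp (c * (x - b))) \<partial>lborel)"
proof -
  have "has_bochner_integral lborel (\<lambda>x. indicator {b - r..b + r} x *\<^sub>R (1 + c * (x - b)))
          (((b + r) + c * (b + r - b)\<^sup>2 / 2) - ((b - r) + c * (b - r - b)\<^sup>2 / 2))"
    using assms
    by (intro has_bochner_integral_FTC_Icc) (auto intro!: derivative_eq_intros continuous_intros
         simp flip: has_real_derivative_iff_has_vector_derivative)
  then have lin: "has_bochner_integral lborel (\<lambda>x. indicator {b - r..b + r} x * (1 + c * (x - b))) (2 * r)"
    by simp
  have int: "integrable lborel (\<lambda>x. indicator {b - r..b + r} x *\<^sub>R exp (c * (x - b)))"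
    by (intro borel_integrable_atLeastAtMost' [unfolded set_integrable_def] continuous_intros)
  have "2 * r = (\<integral>x. indicator {b - r..b + r} x * (1 + c * (x - b)) \<partial>lborel)"
    using lin by (simp add: has_bochner_integral_iff)
  also have "\<dots> \<le> (\<integral>x. indicator {b - r..b + r} x * exp (c * (x - b)) \<partial>lborel)"
    using int lin by (intro integral_mono) (auto simp: has_bochner_integral_iff intro!: mult_left_mono exp_ge_add_one_self)
  finally have "ennreal (2 * r) \<le> ennreal (\<integral>x. indicator {b - r..b + r} x * exp (c * (x - b)) \<partial>lborel)"
    by (rule ennreal_leI)
  also have "\<dots> = (\<integral>\<^sup>+x. ennreal (indicator {b - r..b + r} x * exp (c * (x - b))) \<partial>lborel)"
    using int by (subst nn_integral_eq_integral) auto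
  finally show ?thesis .
qed

section \<open>Design matrix, compatibility number and posterior masses\<close>

lemma Xmul_diff: "Xmul p X (\<lambda>j. f j - g j) i = Xmul p X f i - Xmul p X g i"
  by (simp add: Xmul_def algebra_simps sum_subtractf)

lemma column_le_colnorm:
  assumes "j < p"
  shows "sqrt (\<Sum>i<n. (X i j)\<^sup>2) \<le> colnorm n p X"
  unfolding colnorm_def using assms by (intro Max_ge) auto

lemma colnorm_nonneg: "0 < p \<Longrightarrow> 0 \<le> colnorm n p X"
  using column_le_colnorm[where n = n and j = 0 and p = p and X = X] by (meson order_trans real_sqrt_ge_zero sum_nonneg zero_le_power2)

lemma L2_set_sum_le: "finite J \<Longrightarrow> L2_set (\<lambda>i. \<Sum>j\<in>J. f j i) I \<le> (\<Sum>j\<in>J. L2_set (f j) I)"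
proof (induction J rule: finite_induct)
  case (insert j J)
  then show ?case
    using L2_set_triangle_ineq[of "f j" "\<lambda>i. \<Sum>j\<in>J. f j i" I] by simp
qed (simp add: L2_set_0')

text \<open>\<open>Xb\<close> combines the columns of \<open>X\<close> with coefficients
  \<open>b j\<close>, and each column has norm at most \<open>colnorm n p X\<close>; the triangle
  inequality does the rest.\<close>

lemma norm_Xmul_le:
  "sqrt (\<Sum>i<n. (Xmul p X b i)\<^sup>2) \<le> colnorm n p X * l1 {..<p} b"
proof -
  have "L2_set (\<lambda>i. \<Sum>j<p. X i j * b j) {..<n} \<le> (\<Sum>j<p. L2_set (\<lambda>i. X i j * b j) {..<n})"
    by (rule L2_set_sum_le) simp
  also have "\<dots> = (\<Sum>j<p. L2_set (\<lambda>i. X i j) {..<n} * \<bar>b j\<bar>)"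
    by (intro sum.cong refl) (simp add: L2_set_def power_mult_distrib real_sqrt_mult flip: sum_distrib_right)
  also have "\<dots> \<le> (\<Sum>j<p. colnorm n p X * \<bar>b j\<bar>)"
    using column_le_colnorm by (intro sum_mono mult_right_mono) (auto simp: L2_set_def)
  finally show ?thesis
    by (simp add: L2_set_def Xmul_def l1_def sum_distrib_left)
qed

text \<open>The infimum multiplied out. The product form also covers a vanishing denominator, where
  the left side is 0.\<close>

lemma compat_le:
  assumes "0 < p" "b \<in> vecs p" "S \<subseteq> {..<p}" "l1 ({..<p} - S) b \<le> 7 * l1 S b"
  shows "compat n p X S * (colnorm n p X * l1 S b) \<le> sqrt (\<Sum>i<n. (Xmul p X b i)\<^sup>2) * sqrt (real (card S))"
proof (cases "colnorm n p X * l1 S b = 0")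
  case True
  show ?thesis unfolding True by (simp add: sum_nonneg)
next
  case False
  have nn: "0 \<le> colnorm n p X" "0 \<le> l1 S f" for f
    using colnorm_nonneg[OF assms(1)] by (simp_all add: l1_def sum_nonneg)
  have "\<exists>i\<in>S. b i \<noteq> 0"
    using False by (auto simp: l1_def intro: ccontr)
  then have "compat n p X S \<le> sqrt (\<Sum>i<n. (Xmul p X b i)\<^sup>2) * sqrt (real (card S)) / (colnorm n p X * l1 S b)"
    unfolding compat_def using assms nn
    by (intro cInf_lower bdd_belowI[where m = 0]) (auto intro!: divide_nonneg_nonneg mult_nonneg_nonneg sum_nonneg)
  then show ?thesis
    using False nn(1) nn(2)[of b] by (simp add: pos_le_divide_eq less_le)
qed

section \<open>Integrals over a single model and posterior masses\<close>

lemma ext_measurable [measurable]: "(\<lambda>x. ext S x j) \<in> borel_measurable (PiM S (\<lambda>_. lborel))"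
  by (cases "j \<in> S") (auto simp: ext_def)

lemma ext_in_vecs: "S \<subseteq> {..<p} \<Longrightarrow> ext S x \<in> vecs p"
  by (auto simp: ext_def vecs_def)

lemma laplace_dens_nonneg: "0 \<le> lam \<Longrightarrow> 0 \<le> laplace_dens lam x"
  by (simp add: laplace_dens_def)

lemma laplace_dens_measurable [measurable]: "laplace_dens lam \<in> borel_measurable borel"
  unfolding laplace_dens_def by measurable

lemma prod_laplace_measurable [measurable]:
  "(\<lambda>x. \<Prod>i\<in>S. laplace_dens lam (x i)) \<in> borel_measurable (PiM S (\<lambda>_. lborel))"
  by (intro borel_measurable_prod measurable_compose[OF measurable_component_singleton]) auto

lemma prod_laplace_dens:
  "S \<subseteq> {..<p} \<Longrightarrow> (\<Prod>i\<in>S. laplace_dens lam (x i)) = (lam / 2) ^ card S * exp (- lam * l1 {..<p} (ext S x))"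
proof -
  assume S: "S \<subseteq> {..<p}"
  have "l1 {..<p} (ext S x) = (\<Sum>i\<in>S. \<bar>x i\<bar>)"
    unfolding l1_def using S by (intro sum.mono_neutral_cong_right) (auto simp: ext_def)
  then show ?thesis
    using S finite_subset[OF S]
    unfolding laplace_dens_def prod.distrib by (simp add: exp_sum sum_distrib_left flip: sum_negf)
qed

lemma sqloss_ext_measurable [measurable]:
  "(\<lambda>x. sqloss n p X Y (ext S x)) \<in> borel_measurable (PiM S (\<lambda>_. lborel))"
  unfolding sqloss_def Xmul_def by measurable

text \<open>Exact second-order expansion around \<open>\<gamma>\<close>. At
  \<open>\<gamma> = \<beta>0\<close> the middle sum is the noise term, the only place where the
  noise interacts with \<open>\<beta>\<close>.\<close>

lemma sqloss_expand:
  "sqloss n p X Y \<beta> = sqloss n p X Y \<gamma>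
     - 2 * (\<Sum>i<n. (Y i - Xmul p X \<gamma> i) * Xmul p X (\<lambda>j. \<beta> j - \<gamma> j) i)
     + (\<Sum>i<n. (Xmul p X (\<lambda>j. \<beta> j - \<gamma> j) i)\<^sup>2)"
  unfolding sqloss_def Xmul_diff
  by (simp add: sum_distrib_left power2_eq_square algebra_simps flip: sum_subtractf sum.distrib)

lemma sqloss_nonneg: "0 \<le> sqloss n p X Y \<beta>"
  by (simp add: sqloss_def sum_nonneg)

text \<open>The contribution of one model \<open>S\<close> to \<open>post_num\<close>, before the
  prior weight of the model.\<close>

definition slab_integral ::
    "nat \<Rightarrow> nat \<Rightarrow> (nat \<Rightarrow> nat \<Rightarrow> real) \<Rightarrow> real \<Rightarrow> (nat \<Rightarrow> real) \<Rightarrow> (nat \<Rightarrow> real) set \<Rightarrow> nat set \<Rightarrow> real" where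
  "slab_integral n p X lam Y B S =
     (\<integral>x. indicator B (ext S x) * exp (- sqloss n p X Y (ext S x) / 2)
        * (\<Prod>i\<in>S. laplace_dens lam (x i)) \<partial>(PiM S (\<lambda>_. lborel)))"

lemma post_num_eq:
  "post_num n p X lam \<pi> Y B = (\<Sum>s\<le>p. \<pi> s / real (p choose s) *
     (\<Sum>S\<in>{S. S \<subseteq> {..<p} \<and> card S = s}. slab_integral n p X lam Y B S))"
  by (simp add: post_num_def slab_integral_def)

text \<open>The likelihood factor is at most 1, so the slab density, of total mass 1,
  dominates.\<close>

lemma slab_integrable:
  assumes "finite S" "lam > 0"
  shows "integrable (PiM S (\<lambda>_. lborel))
           (\<lambda>x. exp (- sqloss n p X Y (ext S x) / 2) * (\<Prod>i\<in>S. laplace_dens lam (x i)))"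
proof (rule Bochner_Integration.integrable_bound)
  have "(\<integral>\<^sup>+x. ennreal (\<Prod>i\<in>S. laplace_dens lam (x i)) \<partial>(PiM S (\<lambda>_. lborel))) = 1"
    using assms by (subst nn_integral_PiM_prod) (auto simp: nn_integral_laplace_dens laplace_dens_nonneg)
  then show "integrable (PiM S (\<lambda>_. lborel)) (\<lambda>x. \<Prod>i\<in>S. laplace_dens lam (x i))"
    using assms by (intro integrableI_nonneg) (auto intro!: prod_nonneg laplace_dens_nonneg)
  show "AE x in PiM S (\<lambda>_. lborel). norm (exp (- sqloss n p X Y (ext S x) / 2) * (\<Prod>i\<in>S. laplace_dens lam (x i)))
      \<le> norm (\<Prod>i\<in>S. laplace_dens lam (x i))"
    using assms
    by (auto simp: abs_mult intro!: mult_left_le_one_le sqloss_nonneg)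
qed measurable

lemma slab_integral_UNIV:
  assumes "finite S" "lam > 0"
  shows "ennreal (slab_integral n p X lam Y UNIV S)
    = (\<integral>\<^sup>+x. ennreal (exp (- sqloss n p X Y (ext S x) / 2) * (\<Prod>i\<in>S. laplace_dens lam (x i))) \<partial>(PiM S (\<lambda>_. lborel)))"
  unfolding slab_integral_def indicator_UNIV mult_1_left using assms
  by (subst nn_integral_eq_integral[OF slab_integrable])
     (auto intro!: mult_nonneg_nonneg prod_nonneg laplace_dens_nonneg)

lemma slab_integral_nonneg: "lam > 0 \<Longrightarrow> 0 \<le> slab_integral n p X lam Y B S"
  unfolding slab_integral_def
  by (auto intro!: Bochner_Integration.integral_nonneg mult_nonneg_nonneg prod_nonneg laplace_dens_nonneg)

text \<open>\<open>B\<close> is an arbitrary set, so the left integrand may fail to be integrable;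
  its integral is then 0 by convention, and the inequality holds because the right integrand is
  nonnegative.\<close>

lemma slab_integral_le_UNIV:
  assumes "finite S" "lam > 0"
  shows "slab_integral n p X lam Y B S \<le> slab_integral n p X lam Y UNIV S"
  unfolding slab_integral_def indicator_UNIV mult_1_left
  using assms slab_integrable[OF assms]
  by (intro integral_mono_AE')
    (auto intro!: mult_nonneg_nonneg prod_nonneg laplace_dens_nonneg AE_I2 simp: indicator_def)

text \<open>The support of \<open>ext S x\<close> lies in \<open>S\<close>, so a model with at most
  \<open>R\<close> coordinates never meets \<open>B\<close>.\<close>

lemma slab_integral_eq_0:
  assumes "finite S" "\<not> R < real (card S)" "\<And>\<beta>. \<beta> \<in> B \<Longrightarrow> R < real (card (supp \<beta>))"
  shows "slab_integral n p X lam Y B S = 0"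
proof -
  have "ext S x \<notin> B" for x
  proof
    assume "ext S x \<in> B"
    moreover have "card (supp (ext S x)) \<le> card S"
      using assms(1) by (intro card_mono) (auto simp: supp_def ext_def)
    ultimately show False using assms(3)[of "ext S x"] assms(2) by auto
  qed
  then show ?thesis by (simp add: slab_integral_def)
qed

lemma finite_subset_lessThan: "S \<subseteq> {..<p::nat} \<Longrightarrow> finite S"
  using finite_subset by blast

text \<open>Models with at most \<open>R\<close> coordinates contribute nothing; in the larger ones
  the restriction to \<open>B\<close> is given up.\<close>

lemma post_num_le:
  assumes "lam > 0" "\<And>s. s \<le> p \<Longrightarrow> 0 \<le> \<pi> s"
    and B: "\<And>\<beta>. \<beta> \<in> B \<Longrightarrow> R < real (card (supp \<beta>))"
  shows "post_num n p X lam \<pi> Y B \<le> (\<Sum>s | s \<le> p \<and> R < real s. \<pi> s / real (p choose s) *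
     (\<Sum>S\<in>{S. S \<subseteq> {..<p} \<and> card S = s}. slab_integral n p X lam Y UNIV S))"
proof -
  have zero: "(\<Sum>S\<in>{S. S \<subseteq> {..<p} \<and> card S = s}. slab_integral n p X lam Y B S) = 0"
    if "\<not> R < real s" for s
    using that B by (intro sum.neutral ballI slab_integral_eq_0[where R = R]) (auto intro: finite_subset_lessThan)
  have "post_num n p X lam \<pi> Y B = (\<Sum>s | s \<le> p \<and> R < real s. \<pi> s / real (p choose s) *
     (\<Sum>S\<in>{S. S \<subseteq> {..<p} \<and> card S = s}. slab_integral n p X lam Y B S))"
    unfolding post_num_eq
    by (intro sum.mono_neutral_cong_right)
       (auto simp: zero)
  also have "\<dots> \<le> (\<Sum>s | s \<le> p \<and> R < real s. \<pi> s / real (p choose s) *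
     (\<Sum>S\<in>{S. S \<subseteq> {..<p} \<and> card S = s}. slab_integral n p X lam Y UNIV S))"
    using assms(1,2) by (intro sum_mono mult_left_mono)
      (auto intro: slab_integral_le_UNIV finite_subset_lessThan)
  finally show ?thesis .
qed

lemma post_num_bounds:
  assumes "lam > 0" "\<And>s. s \<le> p \<Longrightarrow> 0 \<le> \<pi> s"
  shows "0 \<le> post_num n p X lam \<pi> Y B" "post_num n p X lam \<pi> Y B \<le> post_num n p X lam \<pi> Y UNIV"
  unfolding post_num_eq using assms
  by (intro sum_nonneg mult_nonneg_nonneg sum_mono mult_left_mono;
      auto intro: slab_integral_nonneg slab_integral_le_UNIV finite_subset_lessThan)+

text \<open>If the normalising constant were 0, the quotient would be 0 by the convention for
  division, which satisfies both bounds.\<close>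

lemma posterior_bounds:
  assumes "lam > 0" "\<And>s. s \<le> p \<Longrightarrow> 0 \<le> \<pi> s"
  shows "0 \<le> posterior n p X lam \<pi> Y B" "posterior n p X lam \<pi> Y B \<le> 1"
  using post_num_bounds[where p = p and \<pi> = \<pi> and n = n and X = X and Y = Y and B = B, OF assms]
  by (auto simp: posterior_def divide_le_eq_1)

section \<open>Lower bound for the normalising constant\<close>

lemma l1_nonneg: "0 \<le> l1 S b"
  by (simp add: l1_def sum_nonneg)

text \<open>Moves \<open>X\<close> to the other side of the inner product as its transpose, which
  brings in the correlations of \<open>e\<close> with the columns.\<close>

lemma noise_inner_eq:
  "(\<Sum>i<n. e i * Xmul p X b i) = (\<Sum>j<p. b j * (\<Sum>i<n. X i j * e i))"
  unfolding Xmul_def sum_distrib_left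
  by (subst sum.swap) (intro sum.cong refl, simp add: algebra_simps)

lemma supp_subset: "\<beta> \<in> vecs p \<Longrightarrow> supp \<beta> \<subseteq> {..<p}"
  by (auto simp: supp_def vecs_def) (meson not_less)

text \<open>The integrand is bounded below on the cube of half-width \<open>r\<close> around \<open>\<beta>0\<close>, where
  \<open>\<parallel>X(\<beta> - \<beta>0)\<parallel> \<le> 1\<close>; what remains is a product over the coordinates.\<close>

lemma slab_integral_lower:
  assumes p: "0 < p" and lam: "0 < lam" and \<beta>0: "\<beta>0 \<in> vecs p"
    and r: "0 \<le> r" "real (card (supp \<beta>0)) * r * colnorm n p X \<le> 1" "lam * r \<le> 1"
  shows "exp (- sqloss n p X Y \<beta>0 / 2) * exp (- 1 / 2) * exp (- lam * l1 {..<p} \<beta>0)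
            * (lam * r * exp (- 1)) ^ card (supp \<beta>0)
         \<le> slab_integral n p X lam Y UNIV (supp \<beta>0)"
proof -
  define S where "S = supp \<beta>0"
  have S: "S \<subseteq> {..<p}" and finS: "finite S"
    using supp_subset[OF \<beta>0] finite_subset_lessThan by (auto simp: S_def)
  \<comment> \<open>The gradient at \<open>\<beta>0\<close> of the log-likelihood: the coefficients
    of the linear term in the expansion.\<close>
  define c where "c j = (\<Sum>i<n. X i j * (Y i - Xmul p X \<beta>0 i))" for j
  define C where "C = exp (- sqloss n p X Y \<beta>0 / 2) * exp (- 1 / 2)"
  \<comment> \<open>Lower bound for the Laplace density within distance \<open>r\<close> of
    \<open>\<beta>0 j\<close>; the factor \<open>exp (- 1)\<close> pays for
    \<open>lam * r \<le> 1\<close>.\<close>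
  define K where "K j = lam / 2 * exp (- lam * \<bar>\<beta>0 j\<bar>) * exp (- 1)" for j
  define f where "f j t = K j * (indicator {\<beta>0 j - r..\<beta>0 j + r} t * exp (c j * (t - \<beta>0 j)))" for j t
  have K: "0 \<le> K j" for j using lam by (simp add: K_def)
  have f_nn: "0 \<le> f j t" for j t using K by (simp add: f_def)
  have f_meas [measurable]: "f j \<in> borel_measurable borel" for j
    unfolding f_def[abs_def] by measurable
  have pointwise: "C * (\<Prod>j\<in>S. f j (x j))
      \<le> exp (- sqloss n p X Y (ext S x) / 2) * (\<Prod>j\<in>S. laplace_dens lam (x j))" for x
  proof (cases "\<forall>j\<in>S. \<bar>x j - \<beta>0 j\<bar> \<le> r")
    \<comment> \<open>Outside the cube some indicator vanishes, so the minorant is 0.\<close>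
    case False
    then obtain j where j: "j \<in> S" "f j (x j) = 0"
      by (force simp: f_def indicator_def abs_le_iff)
    then have "(\<Prod>j\<in>S. f j (x j)) = 0" using finS by auto
    then show ?thesis
      using lam by (auto intro!: mult_nonneg_nonneg prod_nonneg laplace_dens_nonneg)
  next
    case True
    define b where "b = (\<lambda>j. ext S x j - \<beta>0 j)"
    have b_out: "b j = 0" if "j \<notin> S" for j
      using that by (simp add: b_def ext_def S_def supp_def)
    have b_in: "b j = x j - \<beta>0 j" if "j \<in> S" for j
      using that by (simp add: b_def ext_def)
    have "l1 {..<p} b = (\<Sum>j\<in>S. \<bar>b j\<bar>)"
      unfolding l1_def using S by (intro sum.mono_neutral_right) (auto simp: b_out)
    also have "\<dots> \<le> (\<Sum>j\<in>S. r)"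
      using True by (intro sum_mono) (auto simp: b_in)
    finally have "l1 {..<p} b \<le> real (card S) * r" by simp
    then have "colnorm n p X * l1 {..<p} b \<le> 1"
      using r(2) colnorm_nonneg[OF p, of n X]
      by (smt (verit) S_def mult.commute mult_left_mono)
    then have "sqrt (\<Sum>i<n. (Xmul p X b i)\<^sup>2) \<le> 1"
      using norm_Xmul_le[where n = n and p = p and X = X and b = b] by linarith
    then have quad: "(\<Sum>i<n. (Xmul p X b i)\<^sup>2) \<le> 1" by simp
    have "(\<Sum>i<n. (Y i - Xmul p X \<beta>0 i) * Xmul p X b i) = (\<Sum>j<p. b j * c j)"
      by (simp add: noise_inner_eq c_def)
    also have "\<dots> = (\<Sum>j\<in>S. c j * (x j - \<beta>0 j))"
      using S by (intro sum.mono_neutral_cong_right) (auto simp: b_out b_in)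
    finally have lin: "(\<Sum>i<n. (Y i - Xmul p X \<beta>0 i) * Xmul p X b i) = (\<Sum>j\<in>S. c j * (x j - \<beta>0 j))" .
    \<comment> \<open>On the cube the quadratic term is at most 1, which accounts for the factor
      \<open>exp (- 1 / 2)\<close> in \<open>C\<close>.\<close>
    have "C * (\<Prod>j\<in>S. exp (c j * (x j - \<beta>0 j)))
        = exp (- sqloss n p X Y \<beta>0 / 2 + - 1 / 2 + (\<Sum>j\<in>S. c j * (x j - \<beta>0 j)))"
      unfolding C_def exp_add exp_sum[OF finS] ..
    also have "\<dots> \<le> exp (- sqloss n p X Y (ext S x) / 2)"
      using quad lin sqloss_expand[where n = n and p = p and X = X and Y = Y and \<beta> = "ext S x" and \<gamma> = \<beta>0] by (simp add: b_def)
    finally have A: "C * (\<Prod>j\<in>S. exp (c j * (x j - \<beta>0 j))) \<le> exp (- sqloss n p X Y (ext S x) / 2)" .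
    have B: "(\<Prod>j\<in>S. K j) \<le> (\<Prod>j\<in>S. laplace_dens lam (x j))"
    proof (intro prod_mono conjI K)
      fix j assume j: "j \<in> S"
      then have "\<bar>x j\<bar> \<le> \<bar>\<beta>0 j\<bar> + r" using True by force
      then have "lam * \<bar>x j\<bar> \<le> lam * \<bar>\<beta>0 j\<bar> + lam * r"
        using lam by (metis distrib_left mult_le_cancel_left_pos)
      then have "- lam * \<bar>\<beta>0 j\<bar> - 1 \<le> - lam * \<bar>x j\<bar>"
        using r(3) by simp
      then have "exp (- lam * \<bar>\<beta>0 j\<bar>) * exp (- 1) \<le> exp (- lam * \<bar>x j\<bar>)"
        by (simp flip: exp_add)
      then show "K j \<le> laplace_dens lam (x j)"
        using lam by (simp add: K_def laplace_dens_def mult.assoc)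
    qed
    have "(\<Prod>j\<in>S. f j (x j)) = (\<Prod>j\<in>S. K j) * (\<Prod>j\<in>S. exp (c j * (x j - \<beta>0 j)))"
      unfolding prod.distrib[symmetric]
      using True by (intro prod.cong refl) (auto simp: f_def indicator_def abs_le_iff)
    then have "C * (\<Prod>j\<in>S. f j (x j)) = (C * (\<Prod>j\<in>S. exp (c j * (x j - \<beta>0 j)))) * (\<Prod>j\<in>S. K j)"
      by simp
    also have "\<dots> \<le> exp (- sqloss n p X Y (ext S x) / 2) * (\<Prod>j\<in>S. laplace_dens lam (x j))"
      using A B K by (intro mult_mono) (auto intro: prod_nonneg)
    finally show ?thesis .
  qed
  \<comment> \<open>Integrating over an interval symmetric about \<open>\<beta>0 j\<close> removes
    the coefficient \<open>c j\<close>, so the lower bound does not depend on the size of the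
    noise.\<close>
  have one: "ennreal (K j * (2 * r)) \<le> (\<integral>\<^sup>+t. ennreal (f j t) \<partial>lborel)" for j
  proof -
    have "ennreal (K j * (2 * r)) = ennreal (K j) * ennreal (2 * r)"
      using K r by (simp add: ennreal_mult')
    also have "\<dots> \<le> ennreal (K j) * (\<integral>\<^sup>+t. ennreal (indicator {\<beta>0 j - r..\<beta>0 j + r} t * exp (c j * (t - \<beta>0 j))) \<partial>lborel)"
      by (intro mult_left_mono nn_integral_exp_symmetric_interval r) auto
    also have "\<dots> = (\<integral>\<^sup>+t. ennreal (f j t) \<partial>lborel)"
      using K by (subst nn_integral_cmult[symmetric]) (auto simp: f_def ennreal_mult')
    finally show ?thesis .
  qed
  have "(\<Prod>j\<in>S. K j * (2 * r)) = exp (- lam * l1 {..<p} \<beta>0) * (lam * r * exp (- 1)) ^ card S"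
  proof -
    have "l1 {..<p} \<beta>0 = (\<Sum>j\<in>S. \<bar>\<beta>0 j\<bar>)"
      unfolding l1_def using S by (intro sum.mono_neutral_right) (auto simp: S_def supp_def)
    then have "exp (- lam * l1 {..<p} \<beta>0) = (\<Prod>j\<in>S. exp (- lam * \<bar>\<beta>0 j\<bar>))"
      using finS by (simp add: exp_sum sum_distrib_left flip: sum_negf)
    then have "exp (- lam * l1 {..<p} \<beta>0) * (lam * r * exp (- 1)) ^ card S
        = (\<Prod>j\<in>S. exp (- lam * \<bar>\<beta>0 j\<bar>) * (lam * r * exp (- 1)))"
      by (simp add: prod.distrib)
    also have "\<dots> = (\<Prod>j\<in>S. K j * (2 * r))"
      by (intro prod.cong refl) (simp add: K_def)
    finally show ?thesis by simp
  qed
  then have "ennreal (C * (exp (- lam * l1 {..<p} \<beta>0) * (lam * r * exp (- 1)) ^ card S))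
     = ennreal (C * (\<Prod>j\<in>S. K j * (2 * r)))"
    by simp
  also have "\<dots> = ennreal C * (\<Prod>j\<in>S. ennreal (K j * (2 * r)))"
    using K r by (subst prod_ennreal) (simp_all add: C_def ennreal_mult'[symmetric])
  also have "\<dots> \<le> ennreal C * (\<Prod>j\<in>S. \<integral>\<^sup>+t. ennreal (f j t) \<partial>lborel)"
    by (intro mult_left_mono prod_mono_ennreal one) auto
  also have "\<dots> = ennreal C * (\<integral>\<^sup>+x. ennreal (\<Prod>j\<in>S. f j (x j)) \<partial>(PiM S (\<lambda>_. lborel)))"
    using finS f_nn by (subst nn_integral_PiM_prod) auto
  also have "\<dots> \<le> (\<integral>\<^sup>+x. ennreal (C * (\<Prod>j\<in>S. f j (x j))) \<partial>(PiM S (\<lambda>_. lborel)))"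
  proof -
    have "(\<lambda>x. \<Prod>j\<in>S. f j (x j)) \<in> borel_measurable (PiM S (\<lambda>_. lborel))"
      by (intro borel_measurable_prod measurable_compose[OF measurable_component_singleton]) auto
    then show ?thesis
      by (subst nn_integral_cmult[symmetric]) (auto simp: ennreal_mult' C_def)
  qed
  also have "\<dots> \<le> (\<integral>\<^sup>+x. ennreal (exp (- sqloss n p X Y (ext S x) / 2) * (\<Prod>j\<in>S. laplace_dens lam (x j))) \<partial>(PiM S (\<lambda>_. lborel)))"
    by (intro nn_integral_mono ennreal_leI pointwise)
  also have "\<dots> = ennreal (slab_integral n p X lam Y UNIV S)"
    by (rule slab_integral_UNIV[symmetric, OF finS lam])
  finally show ?thesis
    using slab_integral_nonneg[OF lam] by (simp add: S_def C_def mult.assoc)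
qed

text \<open>One term of the exponential series. At \<open>x = s\<close> it gives the Stirling-type
  bound \<open>s ^ s \<le> exp s * fact s\<close>.\<close>

lemma exp_ge_pow_div_fact: "0 \<le> (x::real) \<Longrightarrow> x ^ s / fact s \<le> exp x"
proof -
  assume x: "0 \<le> x"
  have "(\<Sum>k\<in>{s}. x ^ k /\<^sub>R fact k) \<le> exp x"
    using exp_converges[of x] x
    by (intro sum_le_suminf[THEN order_trans[OF _ eq_refl]]) (auto simp: sums_iff)
  then show ?thesis by (simp add: field_simps)
qed

text \<open>Only the model \<open>supp \<beta>0\<close> is kept. Its slab bound has the factor
  \<open>1 / (s p e)\<close> to the power \<open>s\<close>, and its prior weight has
  \<open>1 / (p choose s)\<close>, at least \<open>fact s / p ^ s\<close>. Replacing
  \<open>fact s / s ^ s\<close> by \<open>exp (- s)\<close> collects everything into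
  \<open>(e p)\<close> to the power \<open>- 2 s\<close>.\<close>

lemma post_num_lower:
  assumes p: "0 < p" and lam: "0 < lam" and \<beta>0: "\<beta>0 \<in> vecs p"
    and \<pi>: "\<And>s. s \<le> p \<Longrightarrow> 0 \<le> \<pi> s"
    and N: "0 < colnorm n p X" "colnorm n p X / real p \<le> lam"
  shows "exp (- sqloss n p X Y \<beta>0 / 2) *
           (exp (- 1 / 2) * exp (- lam * l1 {..<p} \<beta>0) * \<pi> (card (supp \<beta>0))
            * (1 / (exp 1 * real p)) ^ (2 * card (supp \<beta>0)))
         \<le> post_num n p X lam \<pi> Y UNIV"
proof -
  define s where "s = card (supp \<beta>0)"
  define N where "N = colnorm n p X"
  \<comment> \<open>The largest half-width allowed by both conditions of the cube bound. For
    \<open>s = 0\<close> the first quotient is 0 by convention, so \<open>r = 0\<close>.\<close>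
  define r where "r = min (1 / (real s * N)) (1 / lam)"
  have sp: "s \<le> p"
    using card_mono[OF _ supp_subset[OF \<beta>0]] by (simp add: s_def)
  have r: "0 \<le> r" "real s * r * N \<le> 1" "lam * r \<le> 1"
  proof -
    show "0 \<le> r" using N lam by (simp add: r_def N_def)
    have "r * (real s * N) \<le> 1 / (real s * N) * (real s * N)"
      using N by (intro mult_right_mono) (auto simp: r_def N_def)
    also have "\<dots> \<le> 1" by simp
    finally show "real s * r * N \<le> 1" by (simp add: mult_ac)
    have "lam * r \<le> lam * (1 / lam)" using lam by (intro mult_left_mono) (auto simp: r_def)
    then show "lam * r \<le> 1" using lam by simp
  qed
  \<comment> \<open>Here the lower bound \<open>N / p \<le> lam\<close> enters: it keeps the cube
    from being too small on the scale \<open>1 / lam\<close> of the prior.\<close>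
  have lr: "1 / (real s * real p) \<le> lam * r"
  proof (cases "s = 0")
    case False
    then have "1 / (real s * real p) \<le> lam / (real s * N)"
      using N lam p by (simp add: N_def field_simps)
    moreover have "1 / (real s * real p) \<le> 1"
      using False p by (simp add: mult_le_one field_simps less_eq_Suc_le mult_ge1_I flip: of_nat_mult)
    ultimately show ?thesis
      using lam by (auto simp: r_def min_def)
  qed (use lam r in simp)
  have s_fact: "real s ^ s \<le> exp (real s) * fact s"
    using exp_ge_pow_div_fact[of "real s" s] by (simp add: divide_le_eq)
  have choose: "real (p choose s) * fact s \<le> real p ^ s"
    using binomial_fact_pow[of p s] by (metis of_nat_fact of_nat_le_iff of_nat_mult of_nat_power)
  have choose_pos: "real (p choose s) > 0" using sp by simp
  have choose_bound: "1 / real p ^ s \<le> 1 / (real (p choose s) * fact s)"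
    using choose choose_pos by (intro frac_le) auto
  \<comment> \<open>Holds at \<open>s = 0\<close> too, since \<open>0 ^ 0 = 1\<close>.\<close>
  have "0 < real s ^ s" by (cases "s = 0") auto
  then have s_bound: "1 / exp (real s) \<le> fact s / real s ^ s"
    using s_fact by (simp add: field_simps)
  have "(1 / (exp 1 * real p)) ^ (2 * s)
      = (1 / real p ^ s) * (1 / exp (real s)) * ((exp (- 1) / real p) ^ s)"
  proof -
    have "1 / (exp 1 * real p) = exp (- 1) / real p"
      by (simp add: exp_minus field_simps)
    moreover have "(exp (- 1) / real p) ^ s = (1 / real p ^ s) * (1 / exp (real s))"
      by (simp add: power_divide exp_minus exp_of_nat_mult[of s "1::real", simplified] divide_inverse power_inverse power_mult_distrib)
    ultimately show ?thesis by (simp only: mult_2 power_add)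
  qed
  also have "\<dots> \<le> (1 / (real (p choose s) * fact s)) * (fact s / real s ^ s) * ((exp (- 1) / real p) ^ s)"
    using choose_bound s_bound choose_pos by (intro mult_right_mono mult_mono) auto
  also have "\<dots> = (1 / real (p choose s)) * (1 / (real s * real p) * exp (- 1)) ^ s"
    by (simp add: power_divide power_mult_distrib)
  also have "\<dots> \<le> (1 / real (p choose s)) * (lam * r * exp (- 1)) ^ s"
    using lr by (intro mult_left_mono power_mono mult_right_mono) auto
  finally have key: "(1 / (exp 1 * real p)) ^ (2 * s) \<le> (1 / real (p choose s)) * (lam * r * exp (- 1)) ^ s" .
  have "exp (- sqloss n p X Y \<beta>0 / 2) *
           (exp (- 1 / 2) * exp (- lam * l1 {..<p} \<beta>0) * \<pi> s * (1 / (exp 1 * real p)) ^ (2 * s))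
      \<le> exp (- sqloss n p X Y \<beta>0 / 2) *
           (exp (- 1 / 2) * exp (- lam * l1 {..<p} \<beta>0) * \<pi> s * ((1 / real (p choose s)) * (lam * r * exp (- 1)) ^ s))"
    using \<pi>[OF sp] by (intro mult_left_mono key) auto
  also have "\<dots> = \<pi> s / real (p choose s) * (exp (- sqloss n p X Y \<beta>0 / 2) * exp (- 1 / 2) * exp (- lam * l1 {..<p} \<beta>0)
            * (lam * r * exp (- 1)) ^ s)"
    by simp
  also have "\<dots> \<le> \<pi> s / real (p choose s) * slab_integral n p X lam Y UNIV (supp \<beta>0)"
    using slab_integral_lower[OF p lam \<beta>0, of r n X Y] r \<pi>[OF sp]
    by (intro mult_left_mono) (auto simp: s_def N_def)
  also have "\<dots> \<le> \<pi> s / real (p choose s) *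
      (\<Sum>S\<in>{S. S \<subseteq> {..<p} \<and> card S = s}. slab_integral n p X lam Y UNIV S)"
    using \<pi>[OF sp] supp_subset[OF \<beta>0]
    by (intro mult_left_mono member_le_sum slab_integral_nonneg[OF lam]) (auto simp: s_def)
  also have "\<dots> \<le> post_num n p X lam \<pi> Y UNIV"
    unfolding post_num_eq using sp \<pi>
    by (intro member_le_sum[where f = "\<lambda>s. \<pi> s / real (p choose s) *
      (\<Sum>S\<in>{S. S \<subseteq> {..<p} \<and> card S = s}. slab_integral n p X lam Y UNIV S)"])
      (auto intro!: mult_nonneg_nonneg divide_nonneg_nonneg sum_nonneg slab_integral_nonneg[OF lam])
  finally show ?thesis by (simp add: s_def)
qed

section \<open>Noise\<close>

definition gauss_dens :: "nat \<Rightarrow> nat \<Rightarrow> (nat \<Rightarrow> nat \<Rightarrow> real) \<Rightarrow> (nat \<Rightarrow> real) \<Rightarrow> (nat \<Rightarrow> real) \<Rightarrow> real" where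
  "gauss_dens n p X \<beta>0 Y = (\<Prod>i<n. std_normal_density (Y i - Xmul p X \<beta>0 i))"

definition noise_inner :: "nat \<Rightarrow> nat \<Rightarrow> (nat \<Rightarrow> nat \<Rightarrow> real) \<Rightarrow> (nat \<Rightarrow> real) \<Rightarrow> (nat \<Rightarrow> real) \<Rightarrow> (nat \<Rightarrow> real) \<Rightarrow> real" where
  "noise_inner n p X \<beta>0 Y v = (\<Sum>i<n. v i * (Y i - Xmul p X \<beta>0 i))"

lemma gauss_dens_nonneg: "0 \<le> gauss_dens n p X \<beta>0 Y"
  by (simp add: gauss_dens_def prod_nonneg)

lemma gauss_dens_measurable [measurable]:
  "gauss_dens n p X \<beta>0 \<in> borel_measurable (PiM {..<n} (\<lambda>_. lborel))"
  unfolding gauss_dens_def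
  by (intro borel_measurable_prod measurable_compose[OF _ borel_measurable_normal_density]
     borel_measurable_diff measurable_component_singleton[THEN measurable_compose]) auto

lemma noise_inner_measurable [measurable]:
  "(\<lambda>Y. noise_inner n p X \<beta>0 Y v) \<in> borel_measurable (PiM {..<n} (\<lambda>_. lborel))"
  unfolding noise_inner_def by measurable

lemma nn_integral_gauss_exp:
  "(\<integral>\<^sup>+Y. ennreal (gauss_dens n p X \<beta>0 Y * exp (noise_inner n p X \<beta>0 Y v)) \<partial>(PiM {..<n} (\<lambda>_. lborel)))
   = ennreal (exp ((\<Sum>i<n. (v i)\<^sup>2) / 2))"
  using gauss_mgf[of n "Xmul p X \<beta>0" v] by (simp add: gauss_dens_def noise_inner_def)

lemma noise_inner_scale: "noise_inner n p X \<beta>0 Y (\<lambda>i. t * v i) = t * noise_inner n p X \<beta>0 Y v"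
  by (simp add: noise_inner_def sum_distrib_left mult.assoc)

lemma noise_inner_Xmul:
  "noise_inner n p X \<beta>0 Y (Xmul p X b) = (\<Sum>j<p. b j * noise_inner n p X \<beta>0 Y (\<lambda>i. X i j))"
  unfolding noise_inner_def by (subst noise_inner_eq[symmetric]) (simp add: mult.commute)

text \<open>Dominates, by Chernoff, the indicator of the event that some \<open>\<bar>X\<^sub>j\<^sup>T\<epsilon>\<bar>\<close> exceeds \<open>L\<close>.\<close>

definition chernoff_tail :: "nat \<Rightarrow> nat \<Rightarrow> (nat \<Rightarrow> nat \<Rightarrow> real) \<Rightarrow> (nat \<Rightarrow> real) \<Rightarrow> real \<Rightarrow> real \<Rightarrow> (nat \<Rightarrow> real) \<Rightarrow> real" where
  "chernoff_tail n p X \<beta>0 t L Y =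
     (\<Sum>j<p. exp (t * noise_inner n p X \<beta>0 Y (\<lambda>i. X i j) - t * L)
            + exp (- t * noise_inner n p X \<beta>0 Y (\<lambda>i. X i j) - t * L))"

lemma chernoff_tail_measurable [measurable]:
  "chernoff_tail n p X \<beta>0 t L \<in> borel_measurable (PiM {..<n} (\<lambda>_. lborel))"
  unfolding chernoff_tail_def by measurable

text \<open>The sign of the noise coordinate decides which of its two exponentials is at least 1;
  all other terms are positive.\<close>

lemma chernoff_tail_ge_1:
  assumes "j < p" "L < \<bar>noise_inner n p X \<beta>0 Y (\<lambda>i. X i j)\<bar>" "0 \<le> t"
  shows "1 \<le> chernoff_tail n p X \<beta>0 t L Y"
proof -
  let ?w = "noise_inner n p X \<beta>0 Y (\<lambda>i. X i j)"
  have "t * L \<le> t * \<bar>?w\<bar>" using assms by (intro mult_left_mono) auto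
  then have "0 \<le> t * ?w - t * L \<or> 0 \<le> - t * ?w - t * L"
    by (cases "0 \<le> ?w") auto
  then have "1 \<le> exp (t * ?w - t * L) + exp (- t * ?w - t * L)"
    by (smt (verit) exp_gt_zero one_le_exp_iff)
  also have "\<dots> \<le> chernoff_tail n p X \<beta>0 t L Y"
    unfolding chernoff_tail_def using assms(1)
    by (intro member_le_sum[where f = "\<lambda>j. exp (t * noise_inner n p X \<beta>0 Y (\<lambda>i. X i j) - t * L)
            + exp (- t * noise_inner n p X \<beta>0 Y (\<lambda>i. X i j) - t * L)"]) (auto intro!: add_nonneg_nonneg)
  finally show ?thesis .
qed

text \<open>The slope \<open>t = L / N^2\<close> minimises \<open>t^2 N^2 / 2 - t L\<close>, with
  minimum \<open>- L^2 / (2 N^2) = - 2 ln p\<close>. Each of the \<open>2 p\<close> exponentials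
  thus has expectation at most \<open>1 / p^2\<close>.\<close>

lemma nn_integral_chernoff_tail:
  fixes n p :: nat and X :: "nat \<Rightarrow> nat \<Rightarrow> real"
  defines "N \<equiv> colnorm n p X"
  assumes p: "1 < p" and N: "0 < N" and L: "L = 2 * N * sqrt (ln (real p))"
  shows "(\<integral>\<^sup>+Y. ennreal (gauss_dens n p X \<beta>0 Y * chernoff_tail n p X \<beta>0 (L / N\<^sup>2) L Y) \<partial>(PiM {..<n} (\<lambda>_. lborel)))
    \<le> ennreal (2 / real p)"
proof -
  define t where "t = L / N\<^sup>2"
  let ?w = "\<lambda>Y j. noise_inner n p X \<beta>0 Y (\<lambda>i. X i j)"
  \<comment> \<open>The slope \<open>u\<close> stands for both \<open>t\<close> and
    \<open>- t\<close>; only its square enters the bound.\<close>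
  have one: "(\<integral>\<^sup>+Y. ennreal (gauss_dens n p X \<beta>0 Y * exp (u * ?w Y j - t * L)) \<partial>(PiM {..<n} (\<lambda>_. lborel)))
      \<le> ennreal (1 / (real p)\<^sup>2)" if "j < p" "u\<^sup>2 = t\<^sup>2" for j u
  proof -
    have "(\<integral>\<^sup>+Y. ennreal (gauss_dens n p X \<beta>0 Y * exp (u * ?w Y j - t * L)) \<partial>(PiM {..<n} (\<lambda>_. lborel)))
       = (\<integral>\<^sup>+Y. ennreal (exp (- t * L)) * ennreal (gauss_dens n p X \<beta>0 Y * exp (noise_inner n p X \<beta>0 Y (\<lambda>i. u * X i j)))
            \<partial>(PiM {..<n} (\<lambda>_. lborel)))"
      by (intro nn_integral_cong)
         (simp add: noise_inner_scale exp_diff exp_minus divide_inverse mult_ac flip: ennreal_mult')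
    also have "\<dots> = ennreal (exp (- t * L)) * ennreal (exp ((\<Sum>i<n. (u * X i j)\<^sup>2) / 2))"
      by (subst nn_integral_cmult) (auto simp: nn_integral_gauss_exp)
    also have "\<dots> = ennreal (exp (t\<^sup>2 * (\<Sum>i<n. (X i j)\<^sup>2) / 2 - t * L))"
    proof -
      have "(\<Sum>i<n. (u * X i j)\<^sup>2) = t\<^sup>2 * (\<Sum>i<n. (X i j)\<^sup>2)"
        unfolding sum_distrib_left power_mult_distrib that(2) ..
      moreover have "exp (- t * L) * exp (c / 2) = exp (c / 2 - t * L)" for c
        by (simp flip: exp_add)
      ultimately show ?thesis by (simp only: ennreal_mult'[symmetric, OF exp_ge_zero])
    qed
    also have "\<dots> \<le> ennreal (exp (t\<^sup>2 * N\<^sup>2 / 2 - t * L))"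
    proof -
      have "(\<Sum>i<n. (X i j)\<^sup>2) \<le> N\<^sup>2"
        using column_le_colnorm[OF that(1), where n = n and X = X] by (simp add: N_def sqrt_le_D)
      then show ?thesis by (intro ennreal_leI) (simp add: mult_left_mono)
    qed
    also have "t\<^sup>2 * N\<^sup>2 / 2 - t * L = - 2 * ln (real p)"
      using N p by (simp add: t_def L power2_eq_square field_simps)
    also have "exp (- 2 * ln (real p)) = 1 / (real p)\<^sup>2"
    proof -
      have "exp (2 * ln (real p)) = (real p)\<^sup>2"
        using p by (simp add: exp_double)
      then show ?thesis by (simp add: exp_minus divide_inverse)
    qed
    finally show ?thesis .
  qed
  have "(\<integral>\<^sup>+Y. ennreal (gauss_dens n p X \<beta>0 Y * chernoff_tail n p X \<beta>0 t L Y) \<partial>(PiM {..<n} (\<lambda>_. lborel)))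
    = (\<integral>\<^sup>+Y. (\<Sum>j<p. ennreal (gauss_dens n p X \<beta>0 Y * exp (t * ?w Y j - t * L))
               + ennreal (gauss_dens n p X \<beta>0 Y * exp (- t * ?w Y j - t * L))) \<partial>(PiM {..<n} (\<lambda>_. lborel)))"
    by (intro nn_integral_cong)
      (simp add: chernoff_tail_def sum_distrib_left distrib_left gauss_dens_nonneg flip: ennreal_plus sum_ennreal)
  also have "\<dots> = (\<Sum>j<p. (\<integral>\<^sup>+Y. ennreal (gauss_dens n p X \<beta>0 Y * exp (t * ?w Y j - t * L)) \<partial>(PiM {..<n} (\<lambda>_. lborel)))
               + (\<integral>\<^sup>+Y. ennreal (gauss_dens n p X \<beta>0 Y * exp (- t * ?w Y j - t * L)) \<partial>(PiM {..<n} (\<lambda>_. lborel))))"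
    by (subst nn_integral_sum) (auto intro!: sum.cong nn_integral_add)
  also have "\<dots> \<le> (\<Sum>j<p. ennreal (1 / (real p)\<^sup>2) + ennreal (1 / (real p)\<^sup>2))"
    by (intro sum_mono add_mono one) auto
  also have "\<dots> = ennreal (2 / real p)"
    using p by (simp add: power2_eq_square ennreal_of_nat_eq_real_of_nat flip: ennreal_plus ennreal_mult')
  finally show ?thesis by (simp add: t_def)
qed

section \<open>The deterministic inequality between quadratic term and l1-norms\<close>

text \<open>Write \<open>b = \<beta> - \<beta>0\<close>, and let \<open>u\<close> and
  \<open>v\<close> be its l1-norms on and off \<open>supp \<beta>0\<close>. Collecting all l1-terms,
  including the reserve \<open>lam / 4 * (u + v)\<close> kept for the slab integral, leaves
  \<open>lam * (7/4 u - 1/4 v)\<close>. This is positive only for \<open>v < 7 u\<close>, hence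
  inside the cone of the compatibility number, where the quadratic term controls
  \<open>u\<close>.\<close>

lemma exponent_bound:
  fixes n p :: nat and X :: "nat \<Rightarrow> nat \<Rightarrow> real"
  defines "N \<equiv> colnorm n p X"
  defines "L \<equiv> 2 * N * sqrt (ln (real p))"
  assumes p: "1 < p" and N: "0 < N" and lam: "0 < lam" "lam \<le> 2 * L"
    and \<beta>0: "\<beta>0 \<in> vecs p" and \<beta>: "\<beta> \<in> vecs p"
    and \<phi>: "supp \<beta>0 = {} \<or> 0 < compat n p X (supp \<beta>0)"
  shows "- (\<Sum>i<n. (Xmul p X (\<lambda>j. \<beta> j - \<beta>0 j) i)\<^sup>2) / 2
          + (1 - lam / (2 * L))\<^sup>2 * (\<Sum>i<n. (Xmul p X (\<lambda>j. \<beta> j - \<beta>0 j) i)\<^sup>2) / 2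
          + lam / 2 * l1 {..<p} (\<lambda>j. \<beta> j - \<beta>0 j) - lam * l1 {..<p} \<beta>
      \<le> 16 / (compat n p X (supp \<beta>0))\<^sup>2 * (lam / L) * real (card (supp \<beta>0)) * ln (real p)
          - lam * l1 {..<p} \<beta>0 - lam / 4 * l1 {..<p} (\<lambda>j. \<beta> j - \<beta>0 j)"
proof -
  define b where "b = (\<lambda>j. \<beta> j - \<beta>0 j)"
  define S where "S = supp \<beta>0"
  define \<phi>' where "\<phi>' = compat n p X S"
  define Q where "Q = (\<Sum>i<n. (Xmul p X b i)\<^sup>2)"
  define s where "s = real (card S)"
  define a where "a = lam / (2 * L)"
  define K where "K = 16 / \<phi>'\<^sup>2 * (lam / L) * s * ln (real p)"
  define u v where "u = l1 S b" and "v = l1 ({..<p} - S) b"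
  have S: "S \<subseteq> {..<p}" using supp_subset[OF \<beta>0] by (simp add: S_def)
  have lnp: "0 < ln (real p)" using p by simp
  have L: "0 < L" using N lnp by (simp add: L_def)
  have L2: "L\<^sup>2 = 4 * N\<^sup>2 * ln (real p)" using lnp by (simp add: L_def power_mult_distrib)
  have a: "0 < a" "a \<le> 1" using lam L by (auto simp: a_def field_simps)
  have Q: "0 \<le> Q" by (simp add: Q_def sum_nonneg)
  have uv: "0 \<le> u" "0 \<le> v" by (simp_all add: u_def v_def l1_nonneg)
  have split: "l1 {..<p} f = l1 S f + l1 ({..<p} - S) f" for f
    unfolding l1_def using S by (metis finite_lessThan sum.subset_diff add.commute)
  have "l1 S \<beta>0 - l1 S \<beta> \<le> u"
    unfolding u_def l1_def b_def sum_subtractf[symmetric] by (intro sum_mono) auto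
  moreover have "l1 ({..<p} - S) \<beta>0 = 0"
    by (simp add: l1_def S_def supp_def)
  moreover have "l1 ({..<p} - S) \<beta> = v"
    unfolding v_def l1_def by (intro sum.cong) (auto simp: b_def S_def supp_def)
  ultimately have diff: "l1 {..<p} \<beta>0 - l1 {..<p} \<beta> \<le> u - v"
    by (simp add: split)
  \<comment> \<open>From \<open>(1 - a)^2 - 1 = - 2 a + a^2 \<le> - a\<close>, which uses
    \<open>a \<le> 1\<close>, that is \<open>lam \<le> 2 * L\<close>.\<close>
  have quad: "- Q / 2 + (1 - a)\<^sup>2 * Q / 2 \<le> - (a / 2 * Q)"
  proof -
    have "a * a * Q \<le> a * 1 * Q" using a Q by (intro mult_right_mono mult_left_mono) auto
    moreover have "- Q / 2 + (1 - a)\<^sup>2 * Q / 2 = a * a * Q / 2 - a * Q"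
      by (simp add: power2_eq_square field_simps)
    ultimately show ?thesis by simp
  qed
  have K: "0 \<le> K" using lam L lnp by (simp add: K_def s_def)
  \<comment> \<open>Outside the cone the left side is at most 0. An empty \<open>S\<close> is put in
    the same case: there \<open>u = 0\<close>, and nothing is known about the compatibility
    number.\<close>
  have main: "lam * (7 / 4 * u - 1 / 4 * v) \<le> a / 2 * Q + K"
  proof (cases "v \<le> 7 * u \<and> S \<noteq> {}")
    case False
    have "7 / 4 * u - 1 / 4 * v \<le> 0"
      using False uv by (auto simp: u_def l1_def)
    then have "lam * (7 / 4 * u - 1 / 4 * v) \<le> 0" using lam by (simp add: mult_le_0_iff)
    also have "0 \<le> a / 2 * Q + K" using a Q K by simp
    finally show ?thesis .
  next
    case True
    have \<phi>p: "0 < \<phi>'" using \<phi> True by (simp add: \<phi>'_def S_def)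
    have bv: "b \<in> vecs p" using \<beta> \<beta>0 by (simp add: b_def vecs_def)
    have comp: "\<phi>' * (N * u) \<le> sqrt Q * sqrt s"
      using compat_le[of p b S n X] True bv S p by (simp add: \<phi>'_def N_def u_def v_def Q_def s_def)
    have Np: "0 < N * \<phi>'" using N \<phi>p by simp
    define z where "z = sqrt s / (N * \<phi>')"
    have u_le: "u \<le> sqrt Q * z"
      using comp Np by (simp add: z_def pos_le_divide_eq mult_ac)
    have z2: "z\<^sup>2 = s / (N\<^sup>2 * \<phi>'\<^sup>2)"
      by (simp add: z_def power_divide power_mult_distrib s_def)
    text \<open>Completing the square in \<open>\<parallel>Xb\<parallel>\<close>; the constant \<open>49/4\<close> that comes out is below \<open>16\<close>.\<close>
    have "lam * (7 / 4 * u) \<le> lam * (7 / 4 * (sqrt Q * z))"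
      using u_le lam by (intro mult_left_mono) auto
    also have "\<dots> \<le> a / 2 * Q + 49 / 16 * lam * L * z\<^sup>2"
    proof -
      have "0 \<le> lam / (4 * L) * (sqrt Q - 7 / 2 * L * z)\<^sup>2" using lam L by simp
      also have "\<dots> = lam / (4 * L) * ((sqrt Q)\<^sup>2 - 7 * L * z * sqrt Q + 49 / 4 * L\<^sup>2 * z\<^sup>2)"
        by (simp add: power2_eq_square algebra_simps)
      also have "\<dots> = a / 2 * Q - lam * (7 / 4 * (sqrt Q * z)) + 49 / 16 * lam * L * z\<^sup>2"
        using L Q by (simp add: a_def power2_eq_square field_simps)
      finally show ?thesis by linarith
    qed
    also have "49 / 16 * lam * L * z\<^sup>2 \<le> 4 * lam * L * z\<^sup>2"
      using lam L by (intro mult_right_mono) auto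
    \<comment> \<open>Since \<open>L^2 = 4 N^2 ln p\<close>, the coefficient 4 becomes the 16 in
      \<open>K\<close>.\<close>
    also have "4 * lam * L * z\<^sup>2 = K"
    proof -
      have "4 * lam * L * z\<^sup>2 = 4 * (lam / L) * L\<^sup>2 * z\<^sup>2" using L by (simp add: power2_eq_square)
      also have "\<dots> = K" unfolding L2 z2 K_def using N \<phi>p by (simp add: field_simps)
      finally show ?thesis .
    qed
    finally have "lam * (7 / 4 * u) \<le> a / 2 * Q + K" by simp
    moreover have "lam * (7 / 4 * u - 1 / 4 * v) \<le> lam * (7 / 4 * u)"
      using uv lam by (intro mult_left_mono) auto
    ultimately show ?thesis by linarith
  qed
  have "lam * (l1 {..<p} \<beta>0 - l1 {..<p} \<beta>) \<le> lam * (u - v)"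
    using diff lam by (intro mult_left_mono) auto
  then have "lam / 2 * (u + v) + lam * l1 {..<p} \<beta>0 - lam * l1 {..<p} \<beta> + lam / 4 * (u + v) \<le> a / 2 * Q + K"
  proof -
    have "lam / 2 * (u + v) + lam / 4 * (u + v) + lam * (u - v) = lam * (7 / 4 * u - 1 / 4 * v)"
      by (simp add: field_simps)
    then show ?thesis
      using main \<open>lam * (l1 {..<p} \<beta>0 - l1 {..<p} \<beta>) \<le> lam * (u - v)\<close>
      by (simp only: right_diff_distrib[of lam "l1 {..<p} \<beta>0"])
  qed
  moreover have l1b: "l1 {..<p} b = u + v" by (simp add: split u_def v_def)
  ultimately show ?thesis
    using quad unfolding l1b b_def[symmetric] Q_def[symmetric] a_def[symmetric] S_def[symmetric]
      \<phi>'_def[symmetric] s_def[symmetric] K_def[symmetric] l1b by linarith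
qed

section \<open>Upper bound for the expected posterior mass\<close>

text \<open>The posterior integrand relative to the likelihood at \<open>\<beta>0\<close>, with the share
  \<open>lam / (2 * L)\<close> of the noise term replaced by its bound \<open>lam / 2 * \<parallel>\<beta> - \<beta>0\<parallel>\<^sub>1\<close>.\<close>

definition tilted :: "nat \<Rightarrow> nat \<Rightarrow> (nat \<Rightarrow> nat \<Rightarrow> real) \<Rightarrow> real \<Rightarrow> real \<Rightarrow> (nat \<Rightarrow> real) \<Rightarrow> nat set
    \<Rightarrow> (nat \<Rightarrow> real) \<Rightarrow> (nat \<Rightarrow> real) \<Rightarrow> real" where
  "tilted n p X lam L \<beta>0 S Y x =
     exp (- (\<Sum>i<n. (Xmul p X (\<lambda>j. ext S x j - \<beta>0 j) i)\<^sup>2) / 2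
          + (1 - lam / (2 * L)) * noise_inner n p X \<beta>0 Y (Xmul p X (\<lambda>j. ext S x j - \<beta>0 j))
          + lam / 2 * l1 {..<p} (\<lambda>j. ext S x j - \<beta>0 j))
     * (\<Prod>i\<in>S. laplace_dens lam (x i))"

lemma tilted_measurable:
  "(\<lambda>(Y, x). tilted n p X lam L \<beta>0 S Y x)
     \<in> borel_measurable (PiM {..<n} (\<lambda>_. lborel) \<Otimes>\<^sub>M PiM S (\<lambda>_. lborel))"
  unfolding tilted_def noise_inner_def Xmul_def l1_def by measurable

lemma tilted_measurable_snd [measurable]:
  "tilted n p X lam L \<beta>0 S Y \<in> borel_measurable (PiM S (\<lambda>_. lborel))"
  unfolding tilted_def noise_inner_def Xmul_def l1_def by measurable

text \<open>By Hoelder, the noise term is at most \<open>L\<close> times the l1-norm of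
  \<open>\<beta> - \<beta>0\<close>. Only the share \<open>lam / (2 * L)\<close> of it is estimated
  this way, which costs \<open>lam / 2\<close> times that norm; the rest is left for exact
  integration.\<close>

lemma integrand_le_tilted:
  assumes L: "0 < L" and lam: "0 < lam"
    and S: "S \<subseteq> {..<p}"
    and small: "\<And>j. j < p \<Longrightarrow> \<bar>noise_inner n p X \<beta>0 Y (\<lambda>i. X i j)\<bar> \<le> L"
  shows "exp (- sqloss n p X Y (ext S x) / 2) * (\<Prod>i\<in>S. laplace_dens lam (x i))
      \<le> exp (- sqloss n p X Y \<beta>0 / 2) * tilted n p X lam L \<beta>0 S Y x"
proof -
  define b where "b = (\<lambda>j. ext S x j - \<beta>0 j)"
  define w where "w = noise_inner n p X \<beta>0 Y (Xmul p X b)"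
  have "w \<le> (\<Sum>j<p. \<bar>b j\<bar> * L)"
    unfolding w_def noise_inner_Xmul
  proof (intro sum_mono)
    fix j assume "j \<in> {..<p}"
    then have "\<bar>b j * noise_inner n p X \<beta>0 Y (\<lambda>i. X i j)\<bar> \<le> \<bar>b j\<bar> * L"
      unfolding abs_mult by (intro mult_left_mono small) auto
    then show "b j * noise_inner n p X \<beta>0 Y (\<lambda>i. X i j) \<le> \<bar>b j\<bar> * L" by linarith
  qed
  then have "w \<le> L * l1 {..<p} b" by (simp add: l1_def sum_distrib_left mult.commute)
  then have "lam / (2 * L) * w \<le> lam / (2 * L) * (L * l1 {..<p} b)"
    using lam L by (intro mult_left_mono) auto
  then have "w \<le> (1 - lam / (2 * L)) * w + lam / 2 * l1 {..<p} b"
    using L by (simp add: left_diff_distrib)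
  moreover have "- sqloss n p X Y (ext S x) / 2 = - sqloss n p X Y \<beta>0 / 2
      + (w - (\<Sum>i<n. (Xmul p X b i)\<^sup>2) / 2)"
    using sqloss_expand[where n = n and p = p and X = X and Y = Y and \<beta> = "ext S x" and \<gamma> = \<beta>0]
    by (simp add: w_def b_def noise_inner_def mult.commute field_simps)
  ultimately have "exp (- sqloss n p X Y (ext S x) / 2)
     \<le> exp (- sqloss n p X Y \<beta>0 / 2) * exp (- (\<Sum>i<n. (Xmul p X b i)\<^sup>2) / 2
          + (1 - lam / (2 * L)) * w + lam / 2 * l1 {..<p} b)"
    unfolding exp_add[symmetric] by simp
  then show ?thesis
    using lam unfolding tilted_def b_def[symmetric] w_def[symmetric] mult.assoc[symmetric]
    by (intro mult_right_mono prod_nonneg laplace_dens_nonneg) auto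
qed

text \<open>The noise is integrated first, for fixed \<open>x\<close>, by the Gaussian moment
  formula; \<open>exponent_bound\<close> applies to the resulting exponent. The reserve
  \<open>lam / 4\<close> leaves a Laplace-shaped integral of value
  \<open>2 * (lam / 2) / (lam / 4) = 4\<close> in each coordinate of \<open>S\<close>.\<close>

lemma nn_integral_tilted:
  fixes n p :: nat and X :: "nat \<Rightarrow> nat \<Rightarrow> real" and lam :: real and \<beta>0 :: "nat \<Rightarrow> real"
  defines "N \<equiv> colnorm n p X"
  defines "L \<equiv> 2 * N * sqrt (ln (real p))"
  defines "K \<equiv> 16 / (compat n p X (supp \<beta>0))\<^sup>2 * (lam / L) * real (card (supp \<beta>0)) * ln (real p)"
  assumes p: "1 < p" and N: "0 < N" and lam: "0 < lam" "lam \<le> 2 * L"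
    and \<beta>0: "\<beta>0 \<in> vecs p" and S: "S \<subseteq> {..<p}"
    and \<phi>: "supp \<beta>0 = {} \<or> 0 < compat n p X (supp \<beta>0)"
  shows "(\<integral>\<^sup>+Y. ennreal (gauss_dens n p X \<beta>0 Y) * (\<integral>\<^sup>+x. ennreal (tilted n p X lam L \<beta>0 S Y x) \<partial>(PiM S (\<lambda>_. lborel)))
            \<partial>(PiM {..<n} (\<lambda>_. lborel)))
      \<le> ennreal (exp (K - lam * l1 {..<p} \<beta>0) * 4 ^ card S)"
proof -
  have finS: "finite S" using S by (rule finite_subset_lessThan)
  interpret Y: sigma_finite_measure "PiM {..<n} (\<lambda>_. lborel :: real measure)"
    by (rule lborel_prod.sigma_finite) simp
  interpret x: sigma_finite_measure "PiM S (\<lambda>_. lborel :: real measure)"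
    by (rule lborel_prod.sigma_finite) (rule finS)
  interpret pair_sigma_finite "PiM {..<n} (\<lambda>_. lborel :: real measure)" "PiM S (\<lambda>_. lborel :: real measure)" ..
  let ?d = "gauss_dens n p X \<beta>0" and ?T = "tilted n p X lam L \<beta>0 S"
  define Q where "Q x = (\<Sum>i<n. (Xmul p X (\<lambda>j. ext S x j - \<beta>0 j) i)\<^sup>2)" for x
  define l where "l x = l1 {..<p} (\<lambda>j. ext S x j - \<beta>0 j)" for x
  have inner: "(\<integral>\<^sup>+Y. ennreal (?d Y * ?T Y x) \<partial>(PiM {..<n} (\<lambda>_. lborel)))
      \<le> ennreal (exp (K - lam * l1 {..<p} \<beta>0)) * ennreal (\<Prod>i\<in>S. lam / 2 * exp (- (lam / 4) * \<bar>x i - \<beta>0 i\<bar>))" for x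
  proof -
    define v where "v = (\<lambda>i. (1 - lam / (2 * L)) * Xmul p X (\<lambda>j. ext S x j - \<beta>0 j) i)"
    \<comment> \<open>The part of the integrand that does not involve \<open>Y\<close>.\<close>
    define H where "H = exp (- Q x / 2 + lam / 2 * l x) * (\<Prod>i\<in>S. laplace_dens lam (x i))"
    have H: "0 \<le> H" unfolding H_def using lam by (intro mult_nonneg_nonneg prod_nonneg laplace_dens_nonneg) auto
    have dT: "?d Y * ?T Y x = H * (?d Y * exp (noise_inner n p X \<beta>0 Y v))" for Y
      unfolding tilted_def H_def Q_def l_def v_def noise_inner_scale exp_add by (simp only: mult_ac)
    have "(\<integral>\<^sup>+Y. ennreal (?d Y * ?T Y x) \<partial>(PiM {..<n} (\<lambda>_. lborel)))
       = (\<integral>\<^sup>+Y. ennreal H * ennreal (?d Y * exp (noise_inner n p X \<beta>0 Y v)) \<partial>(PiM {..<n} (\<lambda>_. lborel)))"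
      unfolding dT ennreal_mult'[OF H] ..
    also have "\<dots> = ennreal H * ennreal (exp ((\<Sum>i<n. (v i)\<^sup>2) / 2))"
      by (subst nn_integral_cmult) (auto simp: nn_integral_gauss_exp)
    also have "\<dots> = ennreal (H * exp ((\<Sum>i<n. (v i)\<^sup>2) / 2))"
      using H by (simp add: ennreal_mult')
    also have "(\<Sum>i<n. (v i)\<^sup>2) = (1 - lam / (2 * L))\<^sup>2 * Q x"
      by (simp add: v_def Q_def power_mult_distrib sum_distrib_left)
    also have "H * exp ((1 - lam / (2 * L))\<^sup>2 * Q x / 2)
       = (lam / 2) ^ card S * exp (- Q x / 2 + (1 - lam / (2 * L))\<^sup>2 * Q x / 2 + lam / 2 * l x - lam * l1 {..<p} (ext S x))"
    proof -
      have "- Q x / 2 + (1 - lam / (2 * L))\<^sup>2 * Q x / 2 + lam / 2 * l x - lam * l1 {..<p} (ext S x)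
         = (- Q x / 2 + lam / 2 * l x) + (- lam * l1 {..<p} (ext S x) + (1 - lam / (2 * L))\<^sup>2 * Q x / 2)"
        by simp
      then show ?thesis
        unfolding H_def prod_laplace_dens[OF S] by (simp only: exp_add mult_ac)
    qed
    also have "\<dots> \<le> (lam / 2) ^ card S * exp (K - lam * l1 {..<p} \<beta>0 - lam / 4 * l x)"
    proof (intro mult_left_mono)
      show "exp (- Q x / 2 + (1 - lam / (2 * L))\<^sup>2 * Q x / 2 + lam / 2 * l x - lam * l1 {..<p} (ext S x))
         \<le> exp (K - lam * l1 {..<p} \<beta>0 - lam / 4 * l x)"
        using exponent_bound[OF p _ lam(1) _ \<beta>0 ext_in_vecs[OF S, of x] \<phi>] N lam(2)
        unfolding exp_le_cancel_iff Q_def l_def K_def L_def N_def by blast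
    qed (use lam in simp)
    \<comment> \<open>Coordinates outside \<open>S\<close> are dropped from \<open>l x\<close>: they
      do not depend on \<open>x\<close>, and what remains factors over \<open>S\<close>.\<close>
    also have "\<dots> \<le> (lam / 2) ^ card S * exp (K - lam * l1 {..<p} \<beta>0 - lam / 4 * (\<Sum>i\<in>S. \<bar>x i - \<beta>0 i\<bar>))"
    proof -
      have "(\<Sum>i\<in>S. \<bar>x i - \<beta>0 i\<bar>) = (\<Sum>i\<in>S. \<bar>ext S x i - \<beta>0 i\<bar>)"
        by (intro sum.cong) (auto simp: ext_def)
      also have "\<dots> \<le> l x" unfolding l_def l1_def using S by (intro sum_mono2) auto
      finally show ?thesis using lam by (intro mult_left_mono) auto
    qed
    also have "\<dots> = exp (K - lam * l1 {..<p} \<beta>0) * (\<Prod>i\<in>S. lam / 2 * exp (- (lam / 4) * \<bar>x i - \<beta>0 i\<bar>))"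
    proof -
      have "K - lam * l1 {..<p} \<beta>0 - lam / 4 * (\<Sum>i\<in>S. \<bar>x i - \<beta>0 i\<bar>)
         = (K - lam * l1 {..<p} \<beta>0) + - (lam / 4) * (\<Sum>i\<in>S. \<bar>x i - \<beta>0 i\<bar>)"
        by simp
      then show ?thesis
        unfolding prod.distrib prod_constant exp_sum[OF finS, symmetric] sum_distrib_left[symmetric]
        by (simp only: exp_add mult_ac)
    qed
    finally show ?thesis
      by (simp add: ennreal_mult' ennreal_leI)
  qed
  have "(\<integral>\<^sup>+Y. ennreal (?d Y) * (\<integral>\<^sup>+x. ennreal (?T Y x) \<partial>(PiM S (\<lambda>_. lborel))) \<partial>(PiM {..<n} (\<lambda>_. lborel)))
     = (\<integral>\<^sup>+Y. (\<integral>\<^sup>+x. ennreal (?d Y * ?T Y x) \<partial>(PiM S (\<lambda>_. lborel))) \<partial>(PiM {..<n} (\<lambda>_. lborel)))"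
    by (subst nn_integral_cmult[symmetric]) (auto simp: ennreal_mult' gauss_dens_nonneg)
  \<comment> \<open>Tonelli: the pointwise bound \<open>inner\<close> needs the noise integral
    inside.\<close>
  also have "\<dots> = (\<integral>\<^sup>+x. (\<integral>\<^sup>+Y. ennreal (?d Y * ?T Y x) \<partial>(PiM {..<n} (\<lambda>_. lborel))) \<partial>(PiM S (\<lambda>_. lborel)))"
    using tilted_measurable[of n p X lam L \<beta>0 S]
    by (intro Fubini'[symmetric]) (measurable, simp add: split_beta')
  also have "\<dots> \<le> (\<integral>\<^sup>+x. ennreal (exp (K - lam * l1 {..<p} \<beta>0))
        * ennreal (\<Prod>i\<in>S. lam / 2 * exp (- (lam / 4) * \<bar>x i - \<beta>0 i\<bar>)) \<partial>(PiM S (\<lambda>_. lborel)))"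
    by (intro nn_integral_mono inner)
  also have "\<dots> = ennreal (exp (K - lam * l1 {..<p} \<beta>0)) * (\<integral>\<^sup>+x. ennreal (\<Prod>i\<in>S. lam / 2 * exp (- (lam / 4) * \<bar>x i - \<beta>0 i\<bar>))
        \<partial>(PiM S (\<lambda>_. lborel)))"
    by (subst nn_integral_cmult)
       (auto intro!: borel_measurable_prod measurable_compose[OF measurable_component_singleton])
  also have "\<dots> = ennreal (exp (K - lam * l1 {..<p} \<beta>0)) * (\<Prod>i\<in>S. ennreal (2 * (lam / 2) / (lam / 4)))"
  proof -
    have "(\<integral>\<^sup>+x. ennreal (\<Prod>i\<in>S. lam / 2 * exp (- (lam / 4) * \<bar>x i - \<beta>0 i\<bar>)) \<partial>(PiM S (\<lambda>_. lborel)))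
       = (\<Prod>i\<in>S. \<integral>\<^sup>+t. ennreal (lam / 2 * exp (- (lam / 4) * \<bar>t - \<beta>0 i\<bar>)) \<partial>lborel)"
      using lam finS by (intro nn_integral_PiM_prod[where f = "\<lambda>i t. lam / 2 * exp (- (lam / 4) * \<bar>t - \<beta>0 i\<bar>)"]) auto
    also have "\<dots> = (\<Prod>i\<in>S. ennreal (2 * (lam / 2) / (lam / 4)))"
      using lam by (intro prod.cong refl nn_integral_laplace) auto
    finally show ?thesis by simp
  qed
  also have "\<dots> = ennreal (exp (K - lam * l1 {..<p} \<beta>0) * 4 ^ card S)"
    using lam by (simp add: ennreal_mult' ennreal_power[symmetric])
  finally show ?thesis .
qed

lemma expect_nonneg:
  assumes "\<And>Y. 0 \<le> f Y"
  shows "0 \<le> expect n p X \<beta>0 f"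
  unfolding expect_def using assms
  by (auto intro!: Bochner_Integration.integral_nonneg mult_nonneg_nonneg prod_nonneg)

text \<open>\<open>expect\<close> is a Bochner integral. For a non-integrable integrand it is 0, and
  \<open>0 \<le> c\<close> suffices; otherwise it agrees with the nonnegative integral.\<close>

lemma expect_le:
  assumes "\<And>Y. 0 \<le> f Y" "0 \<le> c"
    and "(\<integral>\<^sup>+Y. ennreal (gauss_dens n p X \<beta>0 Y) * ennreal (f Y) \<partial>(PiM {..<n} (\<lambda>_. lborel))) \<le> ennreal c"
  shows "expect n p X \<beta>0 f \<le> c"
proof (cases "integrable (PiM {..<n} (\<lambda>_. lborel)) (\<lambda>Y. f Y * gauss_dens n p X \<beta>0 Y)")
  case True
  have "ennreal (expect n p X \<beta>0 f) = (\<integral>\<^sup>+Y. ennreal (f Y * gauss_dens n p X \<beta>0 Y) \<partial>(PiM {..<n} (\<lambda>_. lborel)))"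
    unfolding expect_def gauss_dens_def[symmetric] using assms(1) gauss_dens_nonneg True
    by (subst nn_integral_eq_integral) (auto intro!: mult_nonneg_nonneg)
  also have "\<dots> \<le> ennreal c"
    using assms(1,3) by (simp add: ennreal_mult' mult.commute)
  finally show ?thesis using assms(2) by simp
next
  case False
  then show ?thesis
    using assms(2) by (simp add: expect_def gauss_dens_def[symmetric] not_integrable_integral_eq)
qed

text \<open>If some column correlation exceeds \<open>L\<close>, the posterior is at most 1 and is
  dominated by the Chernoff sum, of expectation at most \<open>2 / p\<close>. Otherwise numerator
  and normalising constant are compared relative to the likelihood at \<open>\<beta>0\<close>, which
  cancels.\<close>

lemma expect_posterior_le:
  fixes n p :: nat and X :: "nat \<Rightarrow> nat \<Rightarrow> real" and lam :: real and \<beta>0 :: "nat \<Rightarrow> real" and \<pi> :: "nat \<Rightarrow> real"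
  defines "N \<equiv> colnorm n p X"
  defines "L \<equiv> 2 * N * sqrt (ln (real p))"
  defines "s0 \<equiv> card (supp \<beta>0)"
  defines "K \<equiv> 16 / (compat n p X (supp \<beta>0))\<^sup>2 * (lam / L) * real s0 * ln (real p)"
  assumes p: "1 < p" and N: "0 < N" "N / real p \<le> lam" and lam: "0 < lam" "lam \<le> 2 * L"
    and \<beta>0: "\<beta>0 \<in> vecs p"
    and \<phi>: "supp \<beta>0 = {} \<or> 0 < compat n p X (supp \<beta>0)"
    and \<pi>: "\<And>s. s \<le> p \<Longrightarrow> 0 < \<pi> s"
    and B: "\<And>\<beta>. \<beta> \<in> B \<Longrightarrow> R < real (card (supp \<beta>))"
  shows "expect n p X \<beta>0 (\<lambda>Y. posterior n p X lam \<pi> Y B)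
      \<le> 2 / real p + exp (1 / 2) * (exp 1 * real p) ^ (2 * s0) * exp K
           * (\<Sum>s | s \<le> p \<and> R < real s. \<pi> s / \<pi> s0 * 4 ^ s)"
proof -
  let ?d = "gauss_dens n p X \<beta>0" and ?M = "PiM {..<n} (\<lambda>_. lborel :: real measure)"
  let ?T = "\<lambda>S Y. \<integral>\<^sup>+x. ennreal (tilted n p X lam L \<beta>0 S Y x) \<partial>(PiM S (\<lambda>_. lborel))"
  let ?tail = "chernoff_tail n p X \<beta>0 (L / N\<^sup>2) L"
  let ?A = "{s. s \<le> p \<and> R < real s}" and ?P = "\<lambda>s. {S. S \<subseteq> {..<p} \<and> card S = s}"
  \<comment> \<open>The lower bound of \<open>post_num_lower\<close> without the likelihood at
    \<open>\<beta>0\<close>; it is free of \<open>Y\<close>.\<close>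
  define D where "D = exp (- 1 / 2) * exp (- lam * l1 {..<p} \<beta>0) * \<pi> s0 * (1 / (exp 1 * real p)) ^ (2 * s0)"
  have s0: "s0 \<le> p" using card_mono[OF _ supp_subset[OF \<beta>0]] by (simp add: s0_def)
  have D: "0 < D" using \<pi>[OF s0] p by (simp add: D_def)
  have L: "0 < L" using N p by (simp add: L_def)
  have \<pi>0: "\<And>s. s \<le> p \<Longrightarrow> 0 \<le> \<pi> s" using \<pi> less_imp_le by blast
  have finP: "finite (?P s)" for s by simp
  have T_meas: "?T S \<in> borel_measurable ?M" if "S \<subseteq> {..<p}" for S
  proof -
    interpret x: sigma_finite_measure "PiM S (\<lambda>_. lborel :: real measure)"
      using that finite_subset_lessThan by (intro lborel_prod.sigma_finite) auto
    show ?thesis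
      using tilted_measurable[of n p X lam L \<beta>0 S]
      by (intro x.borel_measurable_nn_integral) (simp add: split_beta')
  qed
  have sum2_ennreal: "(\<Sum>s\<in>?A. \<Sum>S\<in>?P s. ennreal (f s S)) = ennreal (\<Sum>s\<in>?A. \<Sum>S\<in>?P s. f s S)"
    if f: "\<And>s S. s \<in> ?A \<Longrightarrow> 0 \<le> f s S" for f :: "nat \<Rightarrow> nat set \<Rightarrow> real"
  proof -
    have "(\<Sum>s\<in>?A. \<Sum>S\<in>?P s. ennreal (f s S)) = (\<Sum>s\<in>?A. ennreal (\<Sum>S\<in>?P s. f s S))"
      by (intro sum.cong refl sum_ennreal f)
    also have "\<dots> = ennreal (\<Sum>s\<in>?A. \<Sum>S\<in>?P s. f s S)"
      by (intro sum_ennreal sum_nonneg f)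
    finally show ?thesis .
  qed
  \<comment> \<open>The two noise cases are merged into one sum of nonnegative terms valid for every
    \<open>Y\<close>, which can be integrated term by term.\<close>
  have pointwise: "ennreal (posterior n p X lam \<pi> Y B)
      \<le> ennreal (?tail Y) + (\<Sum>s\<in>?A. \<Sum>S\<in>?P s. ennreal (\<pi> s / real (p choose s) / D) * ?T S Y)" for Y
  proof (cases "\<forall>j<p. \<bar>noise_inner n p X \<beta>0 Y (\<lambda>i. X i j)\<bar> \<le> L")
    case False
    then obtain j where j: "j < p" "L < \<bar>noise_inner n p X \<beta>0 Y (\<lambda>i. X i j)\<bar>" by force
    have "posterior n p X lam \<pi> Y B \<le> ?tail Y"
      using posterior_bounds(2)[OF lam(1) \<pi>0, where n = n and X = X and Y = Y and B = B]
        chernoff_tail_ge_1[OF j, of "L / N\<^sup>2"] L by fastforce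
    then show ?thesis by (intro add_increasing2) (auto intro: ennreal_leI)
  next
    case True
    define l0 where "l0 = exp (- sqloss n p X Y \<beta>0 / 2)"
    have l0: "0 < l0" by (simp add: l0_def)
    have low: "l0 * D \<le> post_num n p X lam \<pi> Y UNIV"
      using post_num_lower[OF _ lam(1) \<beta>0 \<pi>0, where n = n and X = X and Y = Y] p N
      by (simp add: l0_def D_def s0_def N_def)
    have "posterior n p X lam \<pi> Y B \<le> post_num n p X lam \<pi> Y B / (l0 * D)"
      unfolding posterior_def using low D l0 by (intro frac_le post_num_bounds(1)[OF lam(1) \<pi>0]) auto
    also have "\<dots> \<le> (\<Sum>s\<in>?A. \<pi> s / real (p choose s) * (\<Sum>S\<in>?P s. slab_integral n p X lam Y UNIV S)) / (l0 * D)"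
      using post_num_le[OF lam(1) \<pi>0 B, where n = n and X = X and Y = Y] D l0
      by (intro divide_right_mono) auto
    also have "\<dots> = (\<Sum>s\<in>?A. \<Sum>S\<in>?P s. \<pi> s / real (p choose s) / D * (slab_integral n p X lam Y UNIV S / l0))"
      unfolding sum_divide_distrib sum_distrib_left by (intro sum.cong refl) (simp add: field_simps)
    finally have "ennreal (posterior n p X lam \<pi> Y B)
      \<le> ennreal (\<Sum>s\<in>?A. \<Sum>S\<in>?P s. \<pi> s / real (p choose s) / D * (slab_integral n p X lam Y UNIV S / l0))"
      by (rule ennreal_leI)
    also have "\<dots> = (\<Sum>s\<in>?A. \<Sum>S\<in>?P s. ennreal (\<pi> s / real (p choose s) / D) * ennreal (slab_integral n p X lam Y UNIV S / l0))"
    proof -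
      have w: "0 \<le> \<pi> s / real (p choose s) / D" if "s \<in> ?A" for s using \<pi>0 D that by simp
      have v: "0 \<le> slab_integral n p X lam Y UNIV S / l0" for S
        using slab_integral_nonneg[OF lam(1)] l0 by simp
      have "(\<Sum>s\<in>?A. \<Sum>S\<in>?P s. ennreal (\<pi> s / real (p choose s) / D) * ennreal (slab_integral n p X lam Y UNIV S / l0))
         = (\<Sum>s\<in>?A. \<Sum>S\<in>?P s. ennreal (\<pi> s / real (p choose s) / D * (slab_integral n p X lam Y UNIV S / l0)))"
        by (intro sum.cong refl ennreal_mult[symmetric] w v)
      then show ?thesis
        using w v by (simp only: sum2_ennreal mult_nonneg_nonneg)
    qed
    also have "\<dots> \<le> (\<Sum>s\<in>?A. \<Sum>S\<in>?P s. ennreal (\<pi> s / real (p choose s) / D) * ?T S Y)"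
    proof (intro sum_mono mult_left_mono)
      fix s S assume "S \<in> ?P s"
      then have S: "S \<subseteq> {..<p}" and finS: "finite S" using finite_subset_lessThan by auto
      have "ennreal (slab_integral n p X lam Y UNIV S / l0) = ennreal (1 / l0) * ennreal (slab_integral n p X lam Y UNIV S)"
        using l0 by (simp flip: ennreal_mult')
      also have "\<dots> \<le> ennreal (1 / l0) * (\<integral>\<^sup>+x. ennreal (l0 * tilted n p X lam L \<beta>0 S Y x) \<partial>(PiM S (\<lambda>_. lborel)))"
        unfolding slab_integral_UNIV[OF finS lam(1)] l0_def using True
        by (intro mult_left_mono nn_integral_mono ennreal_leI integrand_le_tilted[OF L lam(1) S]) auto
      also have "\<dots> = ennreal (1 / l0) * (ennreal l0 * ?T S Y)"
        using l0 by (subst nn_integral_cmult[symmetric]) (auto simp: ennreal_mult')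
      also have "\<dots> = ?T S Y"
        using l0 by (simp add: mult.assoc[symmetric] flip: ennreal_mult')
      finally show "ennreal (slab_integral n p X lam Y UNIV S / l0) \<le> ?T S Y" .
    qed simp
    finally show ?thesis by (rule add_increasing[rotated]) simp
  qed
  have "(\<integral>\<^sup>+Y. ennreal (?d Y) * ennreal (posterior n p X lam \<pi> Y B) \<partial>?M)
     \<le> (\<integral>\<^sup>+Y. ennreal (?d Y) * (ennreal (?tail Y) + (\<Sum>s\<in>?A. \<Sum>S\<in>?P s. ennreal (\<pi> s / real (p choose s) / D) * ?T S Y)) \<partial>?M)"
    by (intro nn_integral_mono mult_left_mono pointwise) auto
  also have "\<dots> = (\<integral>\<^sup>+Y. ennreal (?d Y * ?tail Y)
        + (\<Sum>s\<in>?A. \<Sum>S\<in>?P s. ennreal (\<pi> s / real (p choose s) / D) * (ennreal (?d Y) * ?T S Y)) \<partial>?M)"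
    by (intro nn_integral_cong)
       (simp add: distrib_left sum_distrib_left ennreal_mult' gauss_dens_nonneg mult_ac)
  also have "\<dots> = (\<integral>\<^sup>+Y. ennreal (?d Y * ?tail Y) \<partial>?M)
        + (\<Sum>s\<in>?A. \<Sum>S\<in>?P s. ennreal (\<pi> s / real (p choose s) / D) * (\<integral>\<^sup>+Y. ennreal (?d Y) * ?T S Y \<partial>?M))"
  proof -
    have meas: "(\<lambda>Y. c * (ennreal (?d Y) * ?T S Y)) \<in> borel_measurable ?M" if "S \<in> ?P s" for c S s
      using T_meas[of S] that by auto
    have "(\<integral>\<^sup>+Y. (\<Sum>s\<in>?A. \<Sum>S\<in>?P s. ennreal (\<pi> s / real (p choose s) / D) * (ennreal (?d Y) * ?T S Y)) \<partial>?M)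
       = (\<Sum>s\<in>?A. \<integral>\<^sup>+Y. (\<Sum>S\<in>?P s. ennreal (\<pi> s / real (p choose s) / D) * (ennreal (?d Y) * ?T S Y)) \<partial>?M)"
      by (intro nn_integral_sum borel_measurable_sum meas)
    also have "\<dots> = (\<Sum>s\<in>?A. \<Sum>S\<in>?P s. \<integral>\<^sup>+Y. ennreal (\<pi> s / real (p choose s) / D) * (ennreal (?d Y) * ?T S Y) \<partial>?M)"
      by (intro sum.cong refl nn_integral_sum meas)
    also have "\<dots> = (\<Sum>s\<in>?A. \<Sum>S\<in>?P s. ennreal (\<pi> s / real (p choose s) / D) * (\<integral>\<^sup>+Y. ennreal (?d Y) * ?T S Y \<partial>?M))"
      using T_meas by (intro sum.cong refl nn_integral_cmult) auto
    finally show ?thesis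
      by (subst nn_integral_add) (auto intro!: borel_measurable_sum meas simp del: divide_divide_eq_left)
  qed
  also have "\<dots> \<le> ennreal (2 / real p) + (\<Sum>s\<in>?A. \<Sum>S\<in>?P s. ennreal (\<pi> s / real (p choose s) / D)
          * ennreal (exp (K - lam * l1 {..<p} \<beta>0) * 4 ^ card S))"
    using nn_integral_chernoff_tail[OF p, of n X L \<beta>0]
      nn_integral_tilted[OF p _ lam(1) _ \<beta>0 _ \<phi>] N lam(2)
    by (intro add_mono sum_mono mult_left_mono) (auto simp: N_def L_def K_def s0_def)
  also have "\<dots> = ennreal (2 / real p + (\<Sum>s\<in>?A. \<Sum>S\<in>?P s. \<pi> s / real (p choose s) / D
          * (exp (K - lam * l1 {..<p} \<beta>0) * 4 ^ card S)))"
  proof -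
    have w: "0 \<le> \<pi> s / real (p choose s) / D * (exp (K - lam * l1 {..<p} \<beta>0) * 4 ^ m)" if "s \<le> p" for s m
      using \<pi>0[OF that] D by simp
    have "(\<Sum>s\<in>?A. \<Sum>S\<in>?P s. ennreal (\<pi> s / real (p choose s) / D)
          * ennreal (exp (K - lam * l1 {..<p} \<beta>0) * 4 ^ card S))
      = (\<Sum>s\<in>?A. \<Sum>S\<in>?P s. ennreal (\<pi> s / real (p choose s) / D
          * (exp (K - lam * l1 {..<p} \<beta>0) * 4 ^ card S)))"
      using \<pi>0 D by (intro sum.cong refl ennreal_mult[symmetric]) auto
    also have "\<dots> = ennreal (\<Sum>s\<in>?A. \<Sum>S\<in>?P s. \<pi> s / real (p choose s) / D
          * (exp (K - lam * l1 {..<p} \<beta>0) * 4 ^ card S))"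
      by (intro sum2_ennreal w) auto
    moreover have "ennreal (2 / real p + (\<Sum>s\<in>?A. \<Sum>S\<in>?P s. \<pi> s / real (p choose s) / D
          * (exp (K - lam * l1 {..<p} \<beta>0) * 4 ^ card S)))
      = ennreal (2 / real p) + ennreal (\<Sum>s\<in>?A. \<Sum>S\<in>?P s. \<pi> s / real (p choose s) / D
          * (exp (K - lam * l1 {..<p} \<beta>0) * 4 ^ card S))"
      by (intro ennreal_plus sum_nonneg w) auto
    ultimately show ?thesis by (simp only:)
  qed
  also have "(\<Sum>s\<in>?A. \<Sum>S\<in>?P s. \<pi> s / real (p choose s) / D
          * (exp (K - lam * l1 {..<p} \<beta>0) * 4 ^ card S))
      = exp (1 / 2) * (exp 1 * real p) ^ (2 * s0) * exp K * (\<Sum>s\<in>?A. \<pi> s / \<pi> s0 * 4 ^ s)"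
  proof -
    \<comment> \<open>The factors \<open>exp (- lam * l1 {..<p} \<beta>0)\<close> from numerator and
      normalising constant cancel, so the size of \<open>\<beta>0\<close> disappears from the
      bound.\<close>
    have D_inv: "1 / D * exp (K - lam * l1 {..<p} \<beta>0) = exp (1 / 2) * (exp 1 * real p) ^ (2 * s0) * exp K / \<pi> s0"
      using \<pi>[OF s0] p by (simp add: D_def exp_diff exp_minus power_divide divide_simps)
    have "(\<Sum>S\<in>?P s. \<pi> s / real (p choose s) / D * (exp (K - lam * l1 {..<p} \<beta>0) * 4 ^ card S))
      = exp (1 / 2) * (exp 1 * real p) ^ (2 * s0) * exp K * (\<pi> s / \<pi> s0 * 4 ^ s)" if "s \<in> ?A" for s
    proof -
      have "(\<Sum>S\<in>?P s. \<pi> s / real (p choose s) / D * (exp (K - lam * l1 {..<p} \<beta>0) * 4 ^ card S))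
         = (\<Sum>S\<in>?P s. \<pi> s / real (p choose s) / D * (exp (K - lam * l1 {..<p} \<beta>0) * 4 ^ s))"
        by (intro sum.cong) auto
      \<comment> \<open>The number of models of size \<open>s\<close> cancels the uniform weight of
        each.\<close>
      also have "\<dots> = real (p choose s) * (\<pi> s / real (p choose s) / D * (exp (K - lam * l1 {..<p} \<beta>0) * 4 ^ s))"
        using n_subsets[of "{..<p}" s] by simp
      also have "\<dots> = (1 / D * exp (K - lam * l1 {..<p} \<beta>0)) * (\<pi> s * 4 ^ s)"
        using that by simp
      finally show ?thesis unfolding D_inv by simp
    qed
    then show ?thesis by (simp add: sum_distrib_left)
  qed
  finally show ?thesis
    using \<pi>0 \<pi> s0
    by (intro expect_le posterior_bounds[OF lam(1) \<pi>0])
       (auto intro!: add_nonneg_nonneg mult_nonneg_nonneg sum_nonneg divide_nonneg_nonneg)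
qed

section \<open>Decay of the prior on the dimension\<close>

lemma prior_ratio_le:
  fixes \<pi> :: "nat \<Rightarrow> real"
  assumes "0 \<le> r" and pos: "\<And>s. s \<le> p \<Longrightarrow> 0 < \<pi> s"
    and step: "\<And>s. 1 \<le> s \<Longrightarrow> s \<le> p \<Longrightarrow> \<pi> s \<le> r * \<pi> (s - 1)"
    and "k + d \<le> p"
  shows "\<pi> (k + d) / \<pi> k \<le> r ^ d"
  using \<open>k + d \<le> p\<close>
proof (induction d)
  case 0
  then show ?case using pos[of k] by simp
next
  case (Suc d)
  have "\<pi> (k + Suc d) / \<pi> k \<le> r * \<pi> (k + d) / \<pi> k"
    using step[of "k + Suc d"] Suc.prems pos[of k] by (intro divide_right_mono) auto
  also have "\<dots> = r * (\<pi> (k + d) / \<pi> k)" by simp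
  also have "\<dots> \<le> r * r ^ d" using Suc assms(1) by (intro mult_left_mono) auto
  finally show ?case by simp
qed

text \<open>Each step beyond \<open>k\<close> costs a factor at most \<open>4 r \<le> 1/2\<close>,
  with 4 from the slab and \<open>r\<close> from the prior. The tail is therefore a geometric
  series, at most twice its leading term.\<close>

lemma prior_tail_le:
  fixes \<pi> :: "nat \<Rightarrow> real"
  assumes r: "0 \<le> r" "4 * r \<le> 1 / 2" and pos: "\<And>s. s \<le> p \<Longrightarrow> 0 < \<pi> s"
    and step: "\<And>s. 1 \<le> s \<Longrightarrow> s \<le> p \<Longrightarrow> \<pi> s \<le> r * \<pi> (s - 1)"
    and J: "0 \<le> J"
  shows "(\<Sum>s | s \<le> p \<and> real k + J < real s. \<pi> s / \<pi> k * 4 ^ s)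
      \<le> 2 * 4 ^ k * (4 * r) ^ (nat \<lfloor>J\<rfloor> + 1)"
proof -
  \<comment> \<open>The least natural number strictly above \<open>J\<close>; the \<open>+ 1\<close>
    matters when \<open>J\<close> is an integer, because the sum runs over \<open>s\<close> strictly
    beyond \<open>k + J\<close>.\<close>
  define m where "m = nat \<lfloor>J\<rfloor> + 1"
  let ?I = "{i. k + m + i \<le> p}"
  have fin: "finite ?I" by (rule finite_subset[of _ "{..p}"]) auto
  have le: "\<pi> s / \<pi> k * 4 ^ s \<le> 4 ^ k * (4 * r) ^ (s - k)" if "k \<le> s" "s \<le> p" for s
  proof -
    have "\<pi> s / \<pi> k * 4 ^ s \<le> r ^ (s - k) * 4 ^ (k + (s - k))"
      using prior_ratio_le[where \<pi> = \<pi> and k = k and d = "s - k", OF r(1) pos step] that r(1)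
      by (intro mult_mono) auto
    then show ?thesis by (simp add: power_add power_mult_distrib mult_ac)
  qed
  have "{s. s \<le> p \<and> real k + J < real s} = (\<lambda>i. k + m + i) ` ?I"
  proof (intro equalityI subsetI)
    fix s assume "s \<in> {s. s \<le> p \<and> real k + J < real s}"
    then have s: "s \<le> p" "real k + J < real s" by auto
    then have "J < real_of_int (int s - int k)" by simp
    then have "\<lfloor>J\<rfloor> < int s - int k" by (simp add: floor_less_iff)
    moreover have "0 \<le> \<lfloor>J\<rfloor>" using J by simp
    ultimately have "k + m \<le> s" unfolding m_def by linarith
    then show "s \<in> (\<lambda>i. k + m + i) ` ?I"
      using s by (intro image_eqI[where x = "s - (k + m)"]) auto
  next
    fix s assume "s \<in> (\<lambda>i. k + m + i) ` ?I"
    then obtain i where i: "s = k + m + i" "s \<le> p" by auto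
    have "J < real m" using J by (simp add: m_def) linarith
    then show "s \<in> {s. s \<le> p \<and> real k + J < real s}" using i by simp
  qed
  then have "(\<Sum>s | s \<le> p \<and> real k + J < real s. \<pi> s / \<pi> k * 4 ^ s)
     = (\<Sum>i\<in>?I. \<pi> (k + m + i) / \<pi> k * 4 ^ (k + m + i))"
    by (simp add: sum.reindex inj_on_def)
  also have "\<dots> \<le> (\<Sum>i\<in>?I. 4 ^ k * (4 * r) ^ m * (4 * r) ^ i)"
  proof (intro sum_mono)
    fix i assume "i \<in> ?I"
    then show "\<pi> (k + m + i) / \<pi> k * 4 ^ (k + m + i) \<le> 4 ^ k * (4 * r) ^ m * (4 * r) ^ i"
      using le[of "k + m + i"] by (simp add: power_add mult.assoc)
  qed
  also have "\<dots> = 4 ^ k * (4 * r) ^ m * (\<Sum>i\<in>?I. (4 * r) ^ i)"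
    by (simp add: sum_distrib_left)
  also have "\<dots> \<le> 4 ^ k * (4 * r) ^ m * 2"
  proof (intro mult_left_mono)
    have "(\<Sum>i\<in>?I. (4 * r) ^ i) \<le> (\<Sum>i. (4 * r) ^ i)"
      using r fin by (intro sum_le_suminf summable_geometric) auto
    also have "\<dots> = 1 / (1 - 4 * r)"
      using r by (intro suminf_geometric) auto
    also have "\<dots> \<le> 2" using r by (simp add: field_simps)
    finally show "(\<Sum>i\<in>?I. (4 * r) ^ i) \<le> 2" .
  qed (use r in simp)
  finally show ?thesis by (simp add: m_def mult_ac)
qed

section \<open>Rate uniform in the true parameter, and passage to the limit\<close>

text \<open>With \<open>z\<close> as in the proof, every factor is bounded by a power with exponent
  \<open>z\<close>: the constants by \<open>(4 e^2) powr z\<close>, the powers of \<open>p\<close>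
  by \<open>p powr (2 z)\<close>, the prior decay by \<open>q powr (M / A4 * z)\<close>. The product
  is \<open>(c * p powr (2 - M)) powr z\<close>. For \<open>s0 > 0\<close> one has
  \<open>z \<ge> 1\<close>, so this is at most its base, and \<open>\<beta>0\<close> is gone from
  the bound.\<close>

lemma expect_posterior_le_rate:
  fixes n p :: nat and X :: "nat \<Rightarrow> nat \<Rightarrow> real" and lam A2 A4 M :: real
    and \<beta>0 :: "nat \<Rightarrow> real" and \<pi> :: "nat \<Rightarrow> real"
  defines "N \<equiv> colnorm n p X"
  defines "L \<equiv> 2 * N * sqrt (ln (real p))"
  defines "s0 \<equiv> card (supp \<beta>0)"
  defines "\<phi> \<equiv> compat n p X (supp \<beta>0)"
  defines "q \<equiv> 4 * (A2 * real p powr (- A4))"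
  defines "c \<equiv> 4 * (exp 1)\<^sup>2 * (4 * A2) powr (M / A4)"
  assumes p: "1 < p" and N: "0 < N" "N / real p \<le> lam" and lam: "0 < lam" "lam \<le> 2 * L"
    and A: "0 < A2" "0 < A4" and M: "2 < M"
    and \<beta>0: "\<beta>0 \<in> vecs p"
    and \<pi>: "\<And>s. s \<le> p \<Longrightarrow> 0 < \<pi> s"
    and step: "\<And>s. 1 \<le> s \<Longrightarrow> s \<le> p \<Longrightarrow> \<pi> s \<le> A2 * real p powr (- A4) * \<pi> (s - 1)"
    and q_le: "q \<le> 1 / 2" and c_le: "c * real p powr (2 - M) \<le> 1"
  shows "expect n p X \<beta>0 (\<lambda>Y. posterior n p X lam \<pi> Y
            {\<beta>. (s0 = 0 \<or> \<phi> > 0) \<and>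
                 real (card (supp \<beta>)) > real s0 + M / A4 * (1 + 16 / \<phi>\<^sup>2 * (lam / L)) * real s0})
      \<le> 2 / real p + 2 * exp (1 / 2) * (q + c * real p powr (2 - M))"
proof (cases "s0 = 0 \<or> \<phi> > 0")
  \<comment> \<open>If \<open>\<phi>\<close> is not positive, the guard makes the set empty, in
    accordance with an infinite threshold; the quotient \<open>16 / \<phi>\<^sup>2\<close> alone
    would be 0 at \<open>\<phi> = 0\<close>.\<close>
  case False
  have q: "0 \<le> q" "0 \<le> c * real p powr (2 - M)" using A by (auto simp: q_def c_def)
  have "posterior n p X lam \<pi> Y {} = 0" for Y
    by (simp add: posterior_def post_num_def)
  then show ?thesis using False q by (simp add: expect_def)
next
  case True
  define z where "z = (1 + 16 / \<phi>\<^sup>2 * (lam / L)) * real s0"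
  define J where "J = M / A4 * z"
  define m where "m = nat \<lfloor>J\<rfloor> + 1"
  define K where "K = 16 / \<phi>\<^sup>2 * (lam / L) * real s0 * ln (real p)"
  have L: "0 < L" using N p by (simp add: L_def)
  have q: "0 < q" using A p by (simp add: q_def)
  have z: "real s0 \<le> z" using lam L by (simp add: z_def algebra_simps)
  have J: "0 \<le> J" using z A M by (simp add: J_def)
  have fin_supp: "finite (supp \<beta>0)"
    using supp_subset[OF \<beta>0] by (rule finite_subset_lessThan)
  have qm: "q ^ m \<le> q"
    using power_decreasing[of 1 m q] q q_le by (simp add: m_def)
  have key: "(exp 1 * real p) ^ (2 * s0) * exp K * (4 ^ s0 * q ^ m) \<le> q + c * real p powr (2 - M)"
  proof (cases "s0 = 0")
    \<comment> \<open>Without true signals only the factor \<open>q ^ m\<close> remains, which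
      explains the summand \<open>q\<close> in the bound.\<close>
    case True
    have "0 \<le> c * real p powr (2 - M)" using A by (simp add: c_def)
    then show ?thesis using True qm by (simp add: K_def)
  next
    case False
    have z1: "1 \<le> z" using z False by linarith
    have e: "real p powr u = exp (u * ln (real p))" for u
      using p by (simp add: powr_def)
    have "(exp 1 * real p) ^ (2 * s0) * exp K * (4 ^ s0 * q ^ m)
       = (4 * (exp 1)\<^sup>2) ^ s0 * ((real p) ^ (2 * s0) * exp K) * q ^ m"
      by (simp add: power_mult_distrib power_mult)
    also have "\<dots> \<le> (4 * (exp 1)\<^sup>2) powr z * real p powr (2 * z) * q powr J"
    proof (intro mult_mono)
      have "(4 * (exp 1 :: real)\<^sup>2) ^ s0 = (4 * (exp 1)\<^sup>2) powr real s0"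
        by (simp add: powr_realpow)
      also have "\<dots> \<le> (4 * (exp 1)\<^sup>2) powr z"
        using z one_le_exp_iff[of 1] by (intro powr_mono) (auto intro: order_trans[OF _ mult_mono[of 1 4 1]])
      finally show "(4 * (exp 1 :: real)\<^sup>2) ^ s0 \<le> (4 * (exp 1)\<^sup>2) powr z" .
      have "(real p) ^ (2 * s0) * exp K = real p powr (2 * real s0) * exp K"
        using p by (simp flip: powr_realpow)
      also have "\<dots> = real p powr (2 * real s0 + 16 / \<phi>\<^sup>2 * (lam / L) * real s0)"
        unfolding e K_def by (simp only: exp_add distrib_right)
      also have "\<dots> \<le> real p powr (2 * z)"
      proof (intro powr_mono)
        define y where "y = 16 / \<phi>\<^sup>2 * (lam / L) * real s0"
        have "0 \<le> y" using lam L by (simp add: y_def)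
        moreover have "z = real s0 + y" by (simp only: z_def y_def distrib_right mult_1_left)
        ultimately show "2 * real s0 + 16 / \<phi>\<^sup>2 * (lam / L) * real s0 \<le> 2 * z"
          unfolding y_def[symmetric] by linarith
      qed (use p in simp)
      finally show "(real p) ^ (2 * s0) * exp K \<le> real p powr (2 * z)" .
      \<comment> \<open>As \<open>q < 1\<close> and \<open>J \<le> m\<close>, rounding up the
        exponent is harmless.\<close>
      have "q ^ m = q powr real m" using q by (simp add: powr_realpow)
      also have "\<dots> \<le> q powr J"
      proof (rule powr_mono')
        show "J \<le> real m" using J unfolding m_def by linarith
      qed (use q q_le in simp_all)
      finally show "q ^ m \<le> q powr J" .
    qed (use q in auto)
    also have "\<dots> = (c * real p powr (2 - M)) powr z"
    proof -
      have "q powr J = (4 * A2) powr (M / A4 * z) * real p powr (- M * z)"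
        using A by (simp add: q_def J_def powr_mult powr_powr)
      then have "(4 * (exp 1)\<^sup>2) powr z * real p powr (2 * z) * q powr J
         = ((4 * (exp 1)\<^sup>2) powr z * (4 * A2) powr (M / A4 * z)) * (real p powr (2 * z) * real p powr (- M * z))"
        by (simp only: mult_ac)
      also have "real p powr (2 * z) * real p powr (- M * z) = real p powr ((2 - M) * z)"
        by (simp add: algebra_simps flip: powr_add)
      also have "(4 * (exp 1)\<^sup>2) powr z * (4 * A2) powr (M / A4 * z) * real p powr ((2 - M) * z)
         = (c * real p powr (2 - M)) powr z"
        using A by (simp add: c_def powr_mult powr_powr)
      finally show ?thesis .
    qed
    also have "\<dots> \<le> (c * real p powr (2 - M)) powr 1"
      using z1 c_le A by (intro powr_mono') (auto simp: c_def)
    also have "\<dots> \<le> q + c * real p powr (2 - M)"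
      using q A by (simp add: c_def)
    finally show ?thesis .
  qed
  have \<phi>': "supp \<beta>0 = {} \<or> 0 < compat n p X (supp \<beta>0)"
    using True fin_supp by (auto simp: s0_def \<phi>_def)
  have "expect n p X \<beta>0 (\<lambda>Y. posterior n p X lam \<pi> Y
            {\<beta>. (s0 = 0 \<or> \<phi> > 0) \<and>
                 real (card (supp \<beta>)) > real s0 + M / A4 * (1 + 16 / \<phi>\<^sup>2 * (lam / L)) * real s0})
     \<le> 2 / real p + exp (1 / 2) * (exp 1 * real p) ^ (2 * s0) * exp K
           * (\<Sum>s | s \<le> p \<and> real s0 + J < real s. \<pi> s / \<pi> s0 * 4 ^ s)"
    unfolding K_def \<phi>_def s0_def L_def N_def
    by (rule expect_posterior_le[OF p _ _ lam(1) _ \<beta>0 \<phi>' \<pi>])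
       (use N lam in \<open>auto simp: N_def L_def J_def z_def \<phi>_def s0_def mult.assoc\<close>)
  also have "\<dots> \<le> 2 / real p + exp (1 / 2) * (exp 1 * real p) ^ (2 * s0) * exp K * (2 * 4 ^ s0 * q ^ m)"
    using prior_tail_le[where \<pi> = \<pi> and p = p and k = s0, OF _ _ \<pi> step J] A q_le
    by (intro add_left_mono mult_left_mono) (simp_all add: q_def m_def)
  also have "\<dots> = 2 / real p + 2 * exp (1 / 2) * ((exp 1 * real p) ^ (2 * s0) * exp K * (4 ^ s0 * q ^ m))"
    by simp
  also have "\<dots> \<le> 2 / real p + 2 * exp (1 / 2) * (q + c * real p powr (2 - M))"
    using key by (intro add_left_mono mult_left_mono) auto
  finally show ?thesis .
qed

theorem theorem1:
  fixes A1 A2 A3 A4 M :: real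
    and n p :: "nat \<Rightarrow> nat"
    and X :: "nat \<Rightarrow> nat \<Rightarrow> nat \<Rightarrow> real"
    and lam :: "nat \<Rightarrow> real"
    and \<pi> :: "nat \<Rightarrow> nat \<Rightarrow> real"
  assumes A_pos: "A1 > 0" "A2 > 0" "A3 > 0" "A4 > 0"
    and M: "M > 2"
    and n_lim: "filterlim n at_top sequentially"
    and p_lim: "filterlim p at_top sequentially"
    and lam_pos: "\<And>k. lam k > 0"
    and lam_lo: "\<And>k. colnorm (n k) (p k) (X k) / real (p k) \<le> lam k"
    and lam_hi: "\<And>k. lam k \<le> 2 * (2 * colnorm (n k) (p k) (X k) * sqrt (ln (real (p k))))"
    and pi_nonneg: "\<And>k s. s \<le> p k \<Longrightarrow> \<pi> k s \<ge> 0"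
    and pi_sum: "\<And>k. (\<Sum>s\<le>p k. \<pi> k s) = 1"
    and pi_lo: "\<And>k s. 1 \<le> s \<Longrightarrow> s \<le> p k \<Longrightarrow>
                  A1 * real (p k) powr (- A3) * \<pi> k (s - 1) \<le> \<pi> k s"
    and pi_hi: "\<And>k s. 1 \<le> s \<Longrightarrow> s \<le> p k \<Longrightarrow>
                  \<pi> k s \<le> A2 * real (p k) powr (- A4) * \<pi> k (s - 1)"
  shows "(\<lambda>k. SUP \<beta>0\<in>vecs (p k).
            expect (n k) (p k) (X k) \<beta>0
              (\<lambda>Y. posterior (n k) (p k) (X k) (lam k) (\<pi> k) Y
                 (let s0 = card (supp \<beta>0);
                      \<phi> = compat (n k) (p k) (X k) (supp \<beta>0);
                      lbar = 2 * colnorm (n k) (p k) (X k) * sqrt (ln (real (p k)))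
                  in {\<beta>. (s0 = 0 \<or> \<phi> > 0) \<and>
                         real (card (supp \<beta>)) > real s0 + M / A4 * (1 + 16 / \<phi>\<^sup>2 * (lam k / lbar)) * real s0})))
         \<longlonglongrightarrow> 0"
proof -
  define N where "N k = colnorm (n k) (p k) (X k)" for k
  define L where "L k = 2 * N k * sqrt (ln (real (p k)))" for k
  define q where "q k = 4 * (A2 * real (p k) powr (- A4))" for k
  define c where "c = 4 * (exp 1)\<^sup>2 * (4 * A2) powr (M / A4)"
  define bound where "bound k = 2 / real (p k) + 2 * exp (1 / 2) * (q k + c * real (p k) powr (2 - M))" for k
  define B where "B k \<beta>0 = {\<beta>. (card (supp \<beta>0) = 0 \<or> compat (n k) (p k) (X k) (supp \<beta>0) > 0) \<and>
      real (card (supp \<beta>)) > real (card (supp \<beta>0)) + M / A4 *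
        (1 + 16 / (compat (n k) (p k) (X k) (supp \<beta>0))\<^sup>2 * (lam k / L k)) * real (card (supp \<beta>0))}" for k \<beta>0
  define E where "E k \<beta>0 = expect (n k) (p k) (X k) \<beta>0
      (\<lambda>Y. posterior (n k) (p k) (X k) (lam k) (\<pi> k) Y (B k \<beta>0))" for k \<beta>0
  have p_real: "filterlim (\<lambda>k. real (p k)) at_top sequentially"
    using p_lim by (rule filterlim_compose[OF filterlim_real_sequentially])
  have inv_lim: "(\<lambda>k. 2 / real (p k)) \<longlonglongrightarrow> 0"
    by (intro real_tendsto_divide_at_top[OF tendsto_const p_real])
  have pow_lim: "(\<lambda>k. real (p k) powr u) \<longlonglongrightarrow> 0" if "u < 0" for u
    by (rule tendsto_neg_powr[OF that p_real])
  have q_lim: "q \<longlonglongrightarrow> 0"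
    using tendsto_mult[OF tendsto_const[of "4 * A2"] pow_lim[of "- A4"]] A_pos by (simp add: q_def[abs_def] mult.assoc)
  have c_lim: "(\<lambda>k. c * real (p k) powr (2 - M)) \<longlonglongrightarrow> 0"
    using tendsto_mult[OF tendsto_const[of c] pow_lim[of "2 - M"]] M by simp
  have bound_lim: "bound \<longlonglongrightarrow> 0"
    using tendsto_add[OF inv_lim tendsto_mult[OF tendsto_const[of "2 * exp (1 / 2)"] tendsto_add[OF q_lim c_lim]]]
    by (simp add: bound_def[abs_def])
  \<comment> \<open>Makes the ratios \<open>\<pi> s / \<pi> s0\<close> meaningful. If
    \<open>\<pi> k 0\<close> were 0, the upper recursion would annihilate all weights, against total
    mass 1; the lower recursion then carries positivity upwards.\<close>
  have pi_pos: "0 < \<pi> k s" if "1 < p k" "s \<le> p k" for k s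
  proof -
    have "\<pi> k 0 \<noteq> 0"
    proof
      assume 0: "\<pi> k 0 = 0"
      have "\<pi> k s = 0" if "s \<le> p k" for s
        using that
      proof (induction s)
        case (Suc s)
        then show ?case using pi_hi[of "Suc s" k] pi_nonneg[of "Suc s" k] by simp
      qed (rule 0)
      then show False using pi_sum[of k] by simp
    qed
    then have 0: "0 < \<pi> k 0" using pi_nonneg[of 0 k] by simp
    show ?thesis
      using \<open>s \<le> p k\<close>
    proof (induction s)
      case (Suc s)
      have "0 < A1 * real (p k) powr (- A3) * \<pi> k s" using Suc A_pos \<open>1 < p k\<close> by simp
      then show ?case using pi_lo[of "Suc s" k] Suc.prems by simp
    qed (rule 0)
  qed
  \<comment> \<open>Forced by \<open>0 < lam k\<close> and the upper bound on \<open>lam k\<close>,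
    which is a multiple of \<open>N k\<close>.\<close>
  have N_pos: "0 < N k" if "1 < p k" for k
  proof -
    have "0 < 4 * (N k * sqrt (ln (real (p k))))"
      using lam_pos[of k] lam_hi[of k] by (simp add: N_def)
    then show ?thesis using that by (simp add: zero_less_mult_iff)
  qed
  have E_nonneg: "0 \<le> E k \<beta>0" for k \<beta>0
    unfolding E_def by (intro expect_nonneg posterior_bounds(1) lam_pos pi_nonneg)
  have "eventually (\<lambda>k. 1 < p k) sequentially"
    using p_lim unfolding filterlim_at_top by (auto elim!: allE[of _ 2] eventually_mono)
  moreover have "eventually (\<lambda>k. q k < 1 / 2) sequentially"
    using q_lim by (rule order_tendstoD) simp
  moreover have "eventually (\<lambda>k. c * real (p k) powr (2 - M) < 1) sequentially"
    using c_lim by (rule order_tendstoD) simp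
  \<comment> \<open>As \<open>bound k\<close> does not involve \<open>\<beta>0\<close>, it bounds
    the supremum as well, and the limit follows by squeezing.\<close>
  ultimately have ev: "eventually (\<lambda>k. 0 \<le> (SUP \<beta>0\<in>vecs (p k). E k \<beta>0) \<and> (SUP \<beta>0\<in>vecs (p k). E k \<beta>0) \<le> bound k) sequentially"
  proof eventually_elim
    case (elim k)
    have le: "E k \<beta>0 \<le> bound k" if \<beta>0: "\<beta>0 \<in> vecs (p k)" for \<beta>0
      unfolding E_def B_def bound_def q_def c_def L_def N_def
    proof (rule expect_posterior_le_rate[OF elim(1) _ _ lam_pos _ _ _ M \<beta>0])
      show "0 < colnorm (n k) (p k) (X k)" using N_pos elim(1) by (simp add: N_def)
      show "colnorm (n k) (p k) (X k) / real (p k) \<le> lam k" by (rule lam_lo)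
      show "lam k \<le> 2 * (2 * colnorm (n k) (p k) (X k) * sqrt (ln (real (p k))))" by (rule lam_hi)
      show "0 < A2" "0 < A4" by (fact A_pos)+
      show "0 < \<pi> k s" if "s \<le> p k" for s using pi_pos elim(1) that by simp
      show "\<pi> k s \<le> A2 * real (p k) powr (- A4) * \<pi> k (s - 1)" if "1 \<le> s" "s \<le> p k" for s
        using that by (rule pi_hi)
      show "4 * (A2 * real (p k) powr (- A4)) \<le> 1 / 2" using elim(2) by (simp add: q_def)
      show "4 * (exp 1)\<^sup>2 * (4 * A2) powr (M / A4) * real (p k) powr (2 - M) \<le> 1"
        using elim(3) by (simp add: c_def)
    qed
    \<comment> \<open>A real supremum is controlled only over a nonempty bounded family; the zero
      vector also supplies its lower bound 0.\<close>
    have zero: "(\<lambda>_. 0) \<in> vecs (p k)" by (simp add: vecs_def)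
    have "(SUP \<beta>0\<in>vecs (p k). E k \<beta>0) \<le> bound k"
      using zero le by (intro cSUP_least) auto
    moreover have "E k (\<lambda>_. 0) \<le> (SUP \<beta>0\<in>vecs (p k). E k \<beta>0)"
      using zero le by (intro cSUP_upper bdd_aboveI2)
    ultimately show ?case using E_nonneg[of k "\<lambda>_. 0"] by linarith
  qed
  have "(\<lambda>k. SUP \<beta>0\<in>vecs (p k). E k \<beta>0) \<longlonglongrightarrow> 0"
    using ev by (intro real_tendsto_sandwich[OF _ _ tendsto_const bound_lim]) (auto elim: eventually_mono)
  then show ?thesis
    by (simp only: E_def B_def L_def N_def Let_def)
qed

end
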